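(* There is an algorithm which, given a nonempty $S\subseteq\{A,B,C,D\}$ and a finite, twin-free, inseparable poset $P$, correctly determines whether $P$ is an $S$-order. If $P$ is an $S$-order, it outputs an $S$-representation of $P$; otherwise it outputs a certificate, which is either a forcing cycle in $P$ with value greater than $0$, or a forcing cycle in $P$ with value $0$ such that the subposet induced by its elements has no $S$-representation.
   Context: Interval types: every interval $I_v$ has left endpoint $L(v)$, right endpoint $R(v)$, center $c(v)=(L(v)+R(v))/2$, and one of four types: $A$ (endpoints closed, center closed), $B$ (endpoints open, center open), $C$ (endpoints closed, center open), $D$ (endpoints open, center closed); the center always belongs to the interval. For nonempty $S\subseteq\{A,B,C,D\}$, an $S$-representation of a poset $(X,\prec)$ assigns to each $x\in X$ an interval $I_x$, all of the same positive length, each of type in $S$, such that $x\prec y$ iff (i) $R(x)<c(y)$, or (ii) $R(x)=c(y)$, at least one of $R(x),c(y)$ is open, and at least one of $L(y),c(x)$ is open. An $S$-order is a poset with an $S$-representation. Twins are two elements with the same comparabilities; twin-free means no twins. A poset $(X,\prec)$ is separable if $X$ can be partitioned into nonempty sets $V,W$ with $v\prec w$ for all $v\in V$, $w\in W$; otherwise inseparable. For distinct elements, $x\parallel y$ means incomparable. A forcing cycle is a sequence $x_0,\dots,x_t$ with $t\ge1$, $x_t=x_0$, and $x_i\prec x_{i+1}$ or $x_i\parallel x_{i+1}$ for each $0\le i\le t-1$; its value is the number of indices with $x_i\prec x_{i+1}$ minus the number with $x_i\parallel x_{i+1}$. *)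

theory Defs
  imports Complex_Main "HOL-Library.Nat_Bijection"
begin

definition poset :: "'a set \<Rightarrow> 'a rel \<Rightarrow> bool" where
  "poset X r \<longleftrightarrow> r \<subseteq> X \<times> X \<and> irrefl r \<and> trans r"

definition incomparable :: "'a rel \<Rightarrow> 'a \<Rightarrow> 'a \<Rightarrow> bool" where
  "incomparable r x y \<longleftrightarrow> x \<noteq> y \<and> (x, y) \<notin> r \<and> (y, x) \<notin> r"

definition twins :: "'a set \<Rightarrow> 'a rel \<Rightarrow> 'a \<Rightarrow> 'a \<Rightarrow> bool" where
  "twins X r x y \<longleftrightarrow> x \<in> X \<and> y \<in> X \<and> x \<noteq> y \<and>
     (\<forall>z\<in>X. ((x, z) \<in> r \<longleftrightarrow> (y, z) \<in> r) \<and> ((z, x) \<in> r \<longleftrightarrow> (z, y) \<in> r))"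

definition twin_free :: "'a set \<Rightarrow> 'a rel \<Rightarrow> bool" where
  "twin_free X r \<longleftrightarrow> \<not> (\<exists>x y. twins X r x y)"

definition separable :: "'a set \<Rightarrow> 'a rel \<Rightarrow> bool" where
  "separable X r \<longleftrightarrow> (\<exists>V W. V \<union> W = X \<and> V \<inter> W = {} \<and> V \<noteq> {} \<and> W \<noteq> {} \<and>
     (\<forall>v\<in>V. \<forall>w\<in>W. (v, w) \<in> r))"

definition inseparable :: "'a set \<Rightarrow> 'a rel \<Rightarrow> bool" where
  "inseparable X r \<longleftrightarrow> \<not> separable X r"

datatype itype = TypeA | TypeB | TypeC | TypeD

fun ends_open :: "itype \<Rightarrow> bool" where
  "ends_open TypeA = False"
| "ends_open TypeB = True"
| "ends_open TypeC = False"
| "ends_open TypeD = True"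

fun center_open :: "itype \<Rightarrow> bool" where
  "center_open TypeA = False"
| "center_open TypeB = True"
| "center_open TypeC = True"
| "center_open TypeD = False"

datatype interval = Interval (left_end: real) (right_end: real) (kind: itype)

definition center :: "interval \<Rightarrow> real" where
  "center I = (left_end I + right_end I) / 2"

definition interval_less :: "interval \<Rightarrow> interval \<Rightarrow> bool" where
  "interval_less I J \<longleftrightarrow>
     right_end I < center J \<or>
     (right_end I = center J \<and>
      (ends_open (kind I) \<or> center_open (kind J)) \<and>
      (ends_open (kind J) \<or> center_open (kind I)))"

definition representation ::
  "itype set \<Rightarrow> 'a set \<Rightarrow> 'a rel \<Rightarrow> ('a \<Rightarrow> interval) \<Rightarrow> bool" where
  "representation S X r I \<longleftrightarrow>
     (\<exists>l>0. \<forall>x\<in>X. right_end (I x) - left_end (I x) = l) \<and>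
     (\<forall>x\<in>X. kind (I x) \<in> S) \<and>
     (\<forall>x\<in>X. \<forall>y\<in>X. (x, y) \<in> r \<longleftrightarrow> interval_less (I x) (I y))"

definition S_order :: "itype set \<Rightarrow> 'a set \<Rightarrow> 'a rel \<Rightarrow> bool" where
  "S_order S X r \<longleftrightarrow> poset X r \<and> (\<exists>I. representation S X r I)"

definition forcing_cycle :: "'a set \<Rightarrow> 'a rel \<Rightarrow> 'a list \<Rightarrow> bool" where
  "forcing_cycle X r xs \<longleftrightarrow> length xs \<ge> 2 \<and> set xs \<subseteq> X \<and> last xs = hd xs \<and>
     (\<forall>i < length xs - 1. (xs ! i, xs ! Suc i) \<in> r \<or> incomparable r (xs ! i) (xs ! Suc i))"

definition cycle_value :: "'a rel \<Rightarrow> 'a list \<Rightarrow> int" where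
  "cycle_value r xs =
     int (card {i. i < length xs - 1 \<and> (xs ! i, xs ! Suc i) \<in> r}) -
     int (card {i. i < length xs - 1 \<and> incomparable r (xs ! i) (xs ! Suc i)})"

definition certificate :: "itype set \<Rightarrow> 'a set \<Rightarrow> 'a rel \<Rightarrow> 'a list \<Rightarrow> bool" where
  "certificate S X r xs \<longleftrightarrow> forcing_cycle X r xs \<and>
     (cycle_value r xs > 0 \<or>
      (cycle_value r xs = 0 \<and> \<not> (\<exists>I. representation S (set xs) (Restr r (set xs)) I)))"

text \<open>
  Kleene's general recursive functions: minimization is only applied to functions that have a
  zero for every choice of parameters, so all functions are total. A function of arity \<open>k\<close> is
  modelled on lists; only its values on lists of length \<open>k\<close> are meaningful.
\<close>

inductive general_recursive :: "nat \<Rightarrow> (nat list \<Rightarrow> nat) \<Rightarrow> bool" where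
  zero: "general_recursive k (\<lambda>_. 0)"
| succ: "general_recursive 1 (\<lambda>xs. Suc (hd xs))"
| proj: "i < k \<Longrightarrow> general_recursive k (\<lambda>xs. xs ! i)"
| comp: "general_recursive (length gs) f \<Longrightarrow> \<forall>g\<in>set gs. general_recursive k g \<Longrightarrow>
    general_recursive k (\<lambda>xs. f (map (\<lambda>g. g xs) gs))"
| prim_rec: "general_recursive k f \<Longrightarrow> general_recursive (k + 2) g \<Longrightarrow>
    general_recursive (Suc k) (\<lambda>xs. rec_nat (f (tl xs)) (\<lambda>n y. g (n # y # tl xs)) (hd xs))"
| minimize: "general_recursive (Suc k) f \<Longrightarrow> \<forall>xs. length xs = k \<longrightarrow> (\<exists>n. f (n # xs) = 0) \<Longrightarrow>
    general_recursive k (\<lambda>xs. LEAST n. f (n # xs) = 0)"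

text \<open>
  Finite inputs and outputs are coded by natural numbers through the explicit bijections of
  \<^theory>\<open>HOL-Library.Nat_Bijection\<close>. In an output, the endpoints of intervals are rational
  numbers, where the pair \<open>(p, q)\<close> stands for the fraction \<open>p / (q + 1)\<close>.
\<close>

fun type_code :: "itype \<Rightarrow> nat" where
  "type_code TypeA = 0"
| "type_code TypeB = 1"
| "type_code TypeC = 2"
| "type_code TypeD = 3"

definition input_code :: "itype set \<Rightarrow> nat set \<Rightarrow> nat rel \<Rightarrow> nat" where
  "input_code S X r =
     prod_encode (set_encode (type_code ` S),
       prod_encode (set_encode X, set_encode (prod_encode ` r)))"

type_synonym fraction = "int \<times> nat"

fun fraction_value :: "fraction \<Rightarrow> real" where
  "fraction_value (p, q) = of_int p / of_nat (q + 1)"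

fun fraction_code :: "fraction \<Rightarrow> nat" where
  "fraction_code (p, q) = prod_encode (int_encode p, q)"

type_synonym finterval = "fraction \<times> fraction \<times> itype"

fun interval_of :: "finterval \<Rightarrow> interval" where
  "interval_of (a, b, t) = Interval (fraction_value a) (fraction_value b) t"

fun finterval_code :: "finterval \<Rightarrow> nat" where
  "finterval_code (a, b, t) =
     prod_encode (fraction_code a, prod_encode (fraction_code b, type_code t))"

datatype answer = Rep "(nat \<times> finterval) list" | Cert "nat list"

fun answer_code :: "answer \<Rightarrow> nat" where
  "answer_code (Rep ps) =
     sum_encode (Inl (list_encode (map (\<lambda>(x, J). prod_encode (x, finterval_code J)) ps)))"
| "answer_code (Cert xs) = sum_encode (Inr (list_encode xs))"

definition assignment :: "('a \<times> finterval) list \<Rightarrow> 'a \<Rightarrow> interval" where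
  "assignment ps x = interval_of (the (map_of ps x))"

fun correct_answer :: "itype set \<Rightarrow> nat set \<Rightarrow> nat rel \<Rightarrow> answer \<Rightarrow> bool" where
  "correct_answer S X r (Rep ps) \<longleftrightarrow> S_order S X r \<and>
     distinct (map fst ps) \<and> set (map fst ps) = X \<and> representation S X r (assignment ps)"
| "correct_answer S X r (Cert xs) \<longleftrightarrow> \<not> S_order S X r \<and> certificate S X r xs"

end

theory Submission imports Defs begin

text \<open>
  Only the centers \<open>c\<close> matter: after scaling the half-length to \<open>h\<close>, \<open>x \<prec> y\<close> demands
  \<open>c y \<ge> c x + h\<close> and \<open>x \<parallel> y\<close> demands \<open>c y \<ge> c x - h\<close>, the types being relevant exactly where
  equality holds. If no forcing cycle has positive value, then, as inseparability makes the
  forcing steps strongly connected, the maximal value \<open>D u v\<close> of a walk from \<open>u\<close> to \<open>v\<close> is finite,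
  and \<open>c v = (\<Sum>u. D u v)\<close> with \<open>h = |X|\<close> meets all demands. The summand \<open>u = y\<close> shows
  that a step from \<open>x\<close> to \<open>y\<close> is tight only if it lies on a cycle of value 0. The classes of
  \<open>D x y + D y x = 0\<close> are each covered by one cycle of value 0, whose steps are tight in
  every representation; so types chosen from representations of the classes represent \<open>X\<close>, and a
  class without a representation is a certificate.

  Representability is decidable because a representation can be compressed to one with
  natural number centers bounded in terms of \<open>|X|\<close>, and certificates are then found by search.
\<close>

section \<open>Closure properties of general recursive functions\<close>

text \<open>Members of \<open>general_recursive\<close> are functions on all lists, with accidental
  values off their arity. Asking only for agreement on lists of length \<open>k\<close> allows
  bodies to be rewritten freely.\<close>

definition computable :: "nat \<Rightarrow> (nat list \<Rightarrow> nat) \<Rightarrow> bool" where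
  "computable k f \<longleftrightarrow> (\<exists>g. general_recursive k g \<and> (\<forall>xs. length xs = k \<longrightarrow> g xs = f xs))"

lemma computable_cong:
  assumes "computable k f" "\<And>xs. length xs = k \<Longrightarrow> f xs = g xs"
  shows "computable k g"
  using assms unfolding computable_def by metis

lemma computable_comp:
  assumes f: "computable (length gs) f" and gs: "\<forall>g\<in>set gs. computable k g"
  shows "computable k (\<lambda>xs. f (map (\<lambda>g. g xs) gs))"
proof -
  obtain f' where f': "general_recursive (length gs) f'" "\<And>xs. length xs = length gs \<Longrightarrow> f' xs = f xs"
    using f unfolding computable_def by blast
  have "\<forall>g\<in>set gs. \<exists>g'. general_recursive k g' \<and> (\<forall>xs. length xs = k \<longrightarrow> g' xs = g xs)"
    using gs unfolding computable_def by blast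
  then obtain G where G: "\<And>g. g \<in> set gs \<Longrightarrow> general_recursive k (G g)"
      "\<And>g xs. g \<in> set gs \<Longrightarrow> length xs = k \<Longrightarrow> G g xs = g xs"
    by metis
  have "general_recursive k (\<lambda>xs. f' (map (\<lambda>g. g xs) (map G gs)))"
    by (rule general_recursive.comp) (use f' G in auto)
  moreover have "f' (map (\<lambda>g. g xs) (map G gs)) = f (map (\<lambda>g. g xs) gs)" if "length xs = k" for xs
  proof -
    have "map (\<lambda>g. g xs) (map G gs) = map (\<lambda>g. g xs) gs"
      using G(2) that by simp
    then show ?thesis using f'(2)[of "map (\<lambda>g. g xs) gs"] by (simp only: length_map)
  qed
  ultimately show ?thesis unfolding computable_def by blast
qed

lemma computable_nth: "i < k \<Longrightarrow> computable k (\<lambda>xs. xs ! i)"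
  unfolding computable_def by (auto intro: general_recursive.proj)

text \<open>Bounded sums and quantifiers put one bound variable in front of the arguments, recursion
  puts two. Under nested binders the outer variables therefore occur behind several
  \<open>tl\<close>.\<close>

lemma computable_nth_tl: "Suc i < k \<Longrightarrow> computable k (\<lambda>xs. tl xs ! i)"
  by (rule computable_cong[OF computable_nth[of "Suc i"]]) (auto simp: nth_tl)

lemma computable_nth_tl2: "Suc (Suc i) < k \<Longrightarrow> computable k (\<lambda>xs. tl (tl xs) ! i)"
  by (rule computable_cong[OF computable_nth[of "Suc (Suc i)"]]) (auto simp: nth_tl)

lemma computable_nth_tl3: "Suc (Suc (Suc i)) < k \<Longrightarrow> computable k (\<lambda>xs. tl (tl (tl xs)) ! i)"
  by (rule computable_cong[OF computable_nth[of "Suc (Suc (Suc i))"]]) (auto simp: nth_tl)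

lemma computable_comp1:
  assumes "computable 1 (\<lambda>xs. f (xs ! 0))" "computable k a"
  shows "computable k (\<lambda>xs. f (a xs))"
  using computable_comp[of "[a]" "\<lambda>xs. f (xs ! 0)" k] assms by simp

lemma computable_comp2:
  assumes "computable 2 (\<lambda>xs. f (xs ! 0) (xs ! 1))" "computable k a" "computable k b"
  shows "computable k (\<lambda>xs. f (a xs) (b xs))"
  using computable_comp[of "[a, b]" "\<lambda>xs. f (xs ! 0) (xs ! 1)" k] assms
  by (simp add: numeral_2_eq_2)

lemma computable_comp3:
  assumes "computable 3 (\<lambda>xs. f (xs ! 0) (xs ! 1) (xs ! 2))"
    "computable k a" "computable k b" "computable k c"
  shows "computable k (\<lambda>xs. f (a xs) (b xs) (c xs))"
  using computable_comp[of "[a, b, c]" "\<lambda>xs. f (xs ! 0) (xs ! 1) (xs ! 2)" k] assms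
  by (simp add: numeral_2_eq_2 numeral_3_eq_3)

lemma computable_comp4:
  assumes "computable 4 (\<lambda>xs. f (xs ! 0) (xs ! 1) (xs ! 2) (xs ! 3))"
    "computable k a" "computable k b" "computable k c" "computable k d"
  shows "computable k (\<lambda>xs. f (a xs) (b xs) (c xs) (d xs))"
  using computable_comp[of "[a, b, c, d]" "\<lambda>xs. f (xs ! 0) (xs ! 1) (xs ! 2) (xs ! 3)" k] assms
  by (simp add: numeral_2_eq_2 numeral_3_eq_3 numeral_Bit0)

lemma computable_Suc:
  assumes "computable k a"
  shows "computable k (\<lambda>xs. Suc (a xs))"
proof (rule computable_comp1[OF _ assms])
  show "computable 1 (\<lambda>xs. Suc (xs ! 0))"
    unfolding computable_def
    using general_recursive.succ by (auto simp: length_Suc_conv intro!: exI[of _ "\<lambda>xs. Suc (hd xs)"])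
qed

lemma computable_const: "computable k (\<lambda>_. c)"
proof (induction c)
  case 0
  show ?case unfolding computable_def by (auto intro: general_recursive.zero)
next
  case (Suc c)
  then show ?case by (rule computable_Suc)
qed

text \<open>The constructor \<open>prim_rec\<close> recurses on the first argument. Prefixing the
  bound \<open>b xs\<close> to the whole of \<open>xs\<close> by composition gives a recursion of
  variable length with all of \<open>xs\<close> as parameters.\<close>

lemma computable_rec_nat:
  assumes b: "computable k b" and f: "computable k f"
    and g: "computable (Suc (Suc k)) (\<lambda>ys. g (ys ! 0) (tl ys ! 0) (tl (tl ys)))"
  shows "computable k (\<lambda>xs. rec_nat (f xs) (\<lambda>n y. g n y xs) (b xs))"
proof -
  obtain f' where f': "general_recursive k f'" "\<And>xs. length xs = k \<Longrightarrow> f' xs = f xs"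
    using f unfolding computable_def by blast
  obtain g' where g': "general_recursive (k + 2) g'"
    "\<And>ys. length ys = k + 2 \<Longrightarrow> g' ys = g (ys ! 0) (tl ys ! 0) (tl (tl ys))"
    using g unfolding computable_def by auto
  define R where "R xs = rec_nat (f' (tl xs)) (\<lambda>n y. g' (n # y # tl xs)) (hd xs)" for xs
  have R: "general_recursive (Suc k) R"
    unfolding R_def by (rule general_recursive.prim_rec[OF f'(1) g'(1)])
  have *: "R (n # xs) = rec_nat (f xs) (\<lambda>n y. g n y xs) n" if "length xs = k" for n xs
    unfolding R_def using that f'(2) g'(2) by (induction n) auto
  have "computable (length (b # map (\<lambda>i xs. xs ! i) [0..<k])) R"
    using R unfolding computable_def by auto
  then have "computable k (\<lambda>xs. R (map (\<lambda>g. g xs) (b # map (\<lambda>i xs. xs ! i) [0..<k])))"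
    by (rule computable_comp) (use b in \<open>auto intro: computable_nth\<close>)
  then show ?thesis
  proof (rule computable_cong)
    fix xs :: "nat list" assume xs: "length xs = k"
    have "map (\<lambda>g. g xs) (b # map (\<lambda>i xs. xs ! i) [0..<k]) = b xs # xs"
      using xs by (auto simp: comp_def map_nth)
    then show "R (map (\<lambda>g. g xs) (b # map (\<lambda>i xs. xs ! i) [0..<k])) =
        rec_nat (f xs) (\<lambda>n y. g n y xs) (b xs)"
      using *[OF xs] by simp
  qed
qed

lemmas computable_vars = computable_const computable_nth computable_nth_tl computable_nth_tl2
  computable_nth_tl3 computable_Suc

lemma computable_add:
  assumes "computable k a" "computable k b"
  shows "computable k (\<lambda>xs. a xs + b xs)"
proof -
  have "computable k (\<lambda>xs. rec_nat (b xs) (\<lambda>n y. Suc y) (a xs))"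
    using assms by (intro computable_rec_nat computable_vars) auto
  then show ?thesis
  proof (rule computable_cong)
    have "rec_nat b (\<lambda>n y. Suc y) a = a + b" for a b :: nat
      by (induction a) auto
    then show "rec_nat (b xs) (\<lambda>n y. Suc y) (a xs) = a xs + b xs" for xs .
  qed
qed

lemma computable_mult:
  assumes "computable k a" "computable k b"
  shows "computable k (\<lambda>xs. a xs * b xs)"
proof (rule computable_comp2[OF _ assms])
  \<comment> \<open>The arguments have been replaced by projections: inside the recursion
    \<open>b\<close> would have to be evaluated at \<open>tl (tl ys)\<close>, whereas shifted
    projections are covered by the rules for variables.\<close>
  have "computable 2 (\<lambda>xs. rec_nat 0 (\<lambda>n y. y + xs ! 1) (xs ! 0))"
    by (intro computable_rec_nat computable_add computable_vars) auto
  then show "computable 2 (\<lambda>xs. xs ! 0 * xs ! 1)"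
  proof (rule computable_cong)
    have "rec_nat 0 (\<lambda>n y. y + b) a = a * b" for a b :: nat
      by (induction a) auto
    then show "rec_nat 0 (\<lambda>n y. y + xs ! 1) (xs ! 0) = xs ! 0 * xs ! 1" for xs :: "nat list" .
  qed
qed

lemma computable_power:
  assumes "computable k a" "computable k b"
  shows "computable k (\<lambda>xs. a xs ^ b xs)"
proof (rule computable_comp2[OF _ assms])
  have "computable 2 (\<lambda>xs. rec_nat 1 (\<lambda>n y. xs ! 0 * y) (xs ! 1))"
    by (intro computable_rec_nat computable_mult computable_vars) auto
  then show "computable 2 (\<lambda>xs. (xs ! 0) ^ (xs ! 1))"
  proof (rule computable_cong)
    have "rec_nat 1 (\<lambda>n y. a * y) b = a ^ b" for a b :: nat
      by (induction b) auto
    then show "rec_nat 1 (\<lambda>n y. xs ! 0 * y) (xs ! 1) = (xs ! 0) ^ (xs ! 1)" for xs :: "nat list" .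
  qed
qed

lemma computable_diff:
  assumes "computable k a" "computable k b"
  shows "computable k (\<lambda>xs. a xs - b xs)"
proof -
  have pred: "computable k (\<lambda>xs. f xs - 1)" if "computable k f" for k f
  proof (rule computable_cong)
    \<comment> \<open>This recursion ignores its previous value and returns the last index, which is
      the predecessor.\<close>
    show "computable k (\<lambda>xs. rec_nat 0 (\<lambda>n y. n) (f xs))"
      using that by (intro computable_rec_nat computable_vars) auto
    show "rec_nat 0 (\<lambda>n y. n) (f xs) = f xs - 1" for xs
      by (cases "f xs") auto
  qed
  show ?thesis
  proof (rule computable_comp2[OF _ assms])
    have "computable 2 (\<lambda>xs. rec_nat (xs ! 0) (\<lambda>n y. y - 1) (xs ! 1))"
      by (intro computable_rec_nat pred computable_vars) auto
    then show "computable 2 (\<lambda>xs. xs ! 0 - xs ! 1)"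
    proof (rule computable_cong)
      have "rec_nat a (\<lambda>n y. y - 1) b = a - b" for a b :: nat
        by (induction b) auto
      then show "rec_nat (xs ! 0) (\<lambda>n y. y - 1) (xs ! 1) = xs ! 0 - xs ! 1" for xs :: "nat list" .
    qed
  qed
qed

lemma computable_sum:
  assumes "computable k b" "computable (Suc k) (\<lambda>ys. f (ys ! 0) (tl ys))"
  shows "computable k (\<lambda>xs. \<Sum>i<b xs. f i xs)"
proof (rule computable_cong)
  have "computable (Suc (Suc k)) (\<lambda>ys. f (ys ! 0) (tl (tl ys)))"
  proof (rule computable_cong)
    \<comment> \<open>The recursion passes the partial sum as second argument; \<open>?gs\<close>
      drops it before \<open>f\<close> is applied.\<close>
    let ?gs = "(\<lambda>ys. ys ! 0) # map (\<lambda>i ys. tl (tl ys) ! i) [0..<k]"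
    show "computable (Suc (Suc k)) (\<lambda>ys. f (map (\<lambda>g. g ys) ?gs ! 0) (tl (map (\<lambda>g. g ys) ?gs)))"
      by (rule computable_comp) (use assms(2) in \<open>auto intro: computable_vars\<close>)
    fix ys :: "nat list" assume "length ys = Suc (Suc k)"
    then show "f (map (\<lambda>g. g ys) ?gs ! 0) (tl (map (\<lambda>g. g ys) ?gs)) = f (ys ! 0) (tl (tl ys))"
      by (auto simp: comp_def intro!: arg_cong[of _ _ "f (ys ! 0)"] nth_equalityI)
  qed
  then show "computable k (\<lambda>xs. rec_nat 0 (\<lambda>n y. y + f n xs) (b xs))"
    using assms(1) by (intro computable_rec_nat computable_add computable_vars) auto
  have "rec_nat 0 (\<lambda>n y. y + f n xs) b = (\<Sum>i<b. f i xs)" for b xs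
    by (induction b) auto
  then show "rec_nat 0 (\<lambda>n y. y + f n xs) (b xs) = (\<Sum>i<b xs. f i xs)" for xs .
qed

section \<open>Decidable predicates, bounded quantifiers and unbounded search\<close>

definition decidable :: "nat \<Rightarrow> (nat list \<Rightarrow> bool) \<Rightarrow> bool" where
  "decidable k P \<longleftrightarrow> computable k (\<lambda>xs. of_bool (P xs))"

lemma decidable_cong:
  assumes "decidable k P" "\<And>xs. length xs = k \<Longrightarrow> P xs = Q xs"
  shows "decidable k Q"
  using assms unfolding decidable_def by (auto intro: computable_cong)

lemma computable_of_bool: "decidable k P \<Longrightarrow> computable k (\<lambda>xs. of_bool (P xs))"
  unfolding decidable_def .

lemma decidable_eq:
  assumes "computable k a" "computable k b"
  shows "decidable k (\<lambda>xs. a xs = b xs)"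
  unfolding decidable_def
proof (rule computable_cong)
  \<comment> \<open>Subtraction is truncated, so the sum of the two differences vanishes exactly at
    equality.\<close>
  show "computable k (\<lambda>xs. 1 - ((a xs - b xs) + (b xs - a xs)))"
    using assms by (intro computable_diff computable_add computable_const)
qed auto

lemma decidable_less:
  assumes "computable k a" "computable k b"
  shows "decidable k (\<lambda>xs. a xs < b xs)"
  unfolding decidable_def
proof (rule computable_cong)
  show "computable k (\<lambda>xs. 1 - (1 - (b xs - a xs)))"
    using assms by (intro computable_diff computable_const)
qed auto

lemma decidable_not:
  assumes "decidable k P"
  shows "decidable k (\<lambda>xs. \<not> P xs)"
  unfolding decidable_def
proof (rule computable_cong)
  show "computable k (\<lambda>xs. 1 - of_bool (P xs))"
    using assms unfolding decidable_def by (intro computable_diff computable_const)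
qed auto

lemma decidable_and:
  assumes "decidable k P" "decidable k Q"
  shows "decidable k (\<lambda>xs. P xs \<and> Q xs)"
  unfolding decidable_def
proof (rule computable_cong)
  show "computable k (\<lambda>xs. of_bool (P xs) * of_bool (Q xs))"
    using assms unfolding decidable_def by (intro computable_mult)
qed auto

lemma decidable_or:
  assumes "decidable k P" "decidable k Q"
  shows "decidable k (\<lambda>xs. P xs \<or> Q xs)"
  using decidable_not[OF decidable_and[OF decidable_not[OF assms(1)] decidable_not[OF assms(2)]]]
  by simp

lemma decidable_imp:
  assumes "decidable k P" "decidable k Q"
  shows "decidable k (\<lambda>xs. P xs \<longrightarrow> Q xs)"
  unfolding imp_conv_disj using assms by (intro decidable_or decidable_not)

lemma decidable_iff:
  assumes "decidable k P" "decidable k Q"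
  shows "decidable k (\<lambda>xs. P xs \<longleftrightarrow> Q xs)"
proof (rule decidable_cong)
  show "decidable k (\<lambda>xs. (P xs \<longrightarrow> Q xs) \<and> (Q xs \<longrightarrow> P xs))"
    using assms by (intro decidable_and decidable_imp)
qed blast

text \<open>The number of counterexamples below the bound is a bounded sum, which is compared with
  0.\<close>

lemma decidable_all_less:
  assumes "computable k b" "decidable (Suc k) (\<lambda>ys. P (ys ! 0) (tl ys))"
  shows "decidable k (\<lambda>xs. \<forall>i<b xs. P i xs)"
proof (rule decidable_cong)
  show "decidable k (\<lambda>xs. (\<Sum>i<b xs. of_bool (\<not> P i xs)) = (0::nat))"
    using assms by (intro decidable_eq computable_sum computable_const computable_of_bool decidable_not)
qed auto

lemma decidable_ex_less:
  assumes "computable k b" "decidable (Suc k) (\<lambda>ys. P (ys ! 0) (tl ys))"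
  shows "decidable k (\<lambda>xs. \<exists>i<b xs. P i xs)"
  using decidable_not[OF decidable_all_less[OF assms(1) decidable_not[OF assms(2)]]] by simp

lemma computable_if:
  assumes "decidable k P" "computable k a" "computable k b"
  shows "computable k (\<lambda>xs. if P xs then a xs else b xs)"
proof (rule computable_cong)
  show "computable k (\<lambda>xs. of_bool (P xs) * a xs + of_bool (\<not> P xs) * b xs)"
    using assms by (intro computable_add computable_mult computable_of_bool decidable_not)
qed auto

text \<open>Minimization looks for a zero, so it is applied to the characteristic function of the
  negated predicate. It demands a hit for every argument list of length \<open>k\<close>, also for
  numbers that code no admissible input.\<close>

lemma computable_Least:
  assumes P: "decidable (Suc k) (\<lambda>ys. P (ys ! 0) (tl ys))"
    and ex: "\<And>xs. length xs = k \<Longrightarrow> \<exists>n. P n xs"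
  shows "computable k (\<lambda>xs. LEAST n. P n xs)"
proof -
  obtain g where g: "general_recursive (Suc k) g"
      "\<And>ys. length ys = Suc k \<Longrightarrow> g ys = of_bool (\<not> P (ys ! 0) (tl ys))"
    using decidable_not[OF P] unfolding decidable_def computable_def by auto
  have g0: "g (n # xs) = 0 \<longleftrightarrow> P n xs" if "length xs = k" for n xs
    using g(2)[of "n # xs"] that by simp
  have "general_recursive k (\<lambda>xs. LEAST n. g (n # xs) = 0)"
    using g(1) by (rule general_recursive.minimize) (use g0 ex in auto)
  then show ?thesis
    unfolding computable_def using g0 by auto
qed

lemma decidable_comp2:
  "decidable 2 (\<lambda>xs. P (xs ! 0) (xs ! 1)) \<Longrightarrow> computable k a \<Longrightarrow> computable k b \<Longrightarrow>
   decidable k (\<lambda>xs. P (a xs) (b xs))"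
  unfolding decidable_def by (rule computable_comp2)

lemma decidable_comp3:
  "decidable 3 (\<lambda>xs. P (xs ! 0) (xs ! 1) (xs ! 2)) \<Longrightarrow>
   computable k a \<Longrightarrow> computable k b \<Longrightarrow> computable k c \<Longrightarrow>
   decidable k (\<lambda>xs. P (a xs) (b xs) (c xs))"
  unfolding decidable_def by (rule computable_comp3)

lemma decidable_comp4:
  "decidable 4 (\<lambda>xs. P (xs ! 0) (xs ! 1) (xs ! 2) (xs ! 3)) \<Longrightarrow>
   computable k a \<Longrightarrow> computable k b \<Longrightarrow> computable k c \<Longrightarrow> computable k d \<Longrightarrow>
   decidable k (\<lambda>xs. P (a xs) (b xs) (c xs) (d xs))"
  unfolding decidable_def by (rule computable_comp4)

lemmas computability_intros = computable_vars computable_add computable_mult computable_power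
  computable_diff computable_sum computable_of_bool computable_if decidable_eq decidable_less
  decidable_not decidable_and decidable_or decidable_imp decidable_iff decidable_all_less
  decidable_ex_less

section \<open>Division, and pairing with its inverses\<close>

lemma computable_div:
  assumes "computable k a" "computable k b"
  shows "computable k (\<lambda>xs. a xs div b xs)"
proof (rule computable_comp2[OF _ assms])
  \<comment> \<open>The disjunct for divisor 0 makes the search total and returns 0, in accordance
    with \<open>a div 0 = 0\<close>.\<close>
  have "computable 2 (\<lambda>xs. LEAST q. xs ! 1 = 0 \<or> xs ! 0 < Suc q * xs ! 1)"
  proof (rule computable_Least)
    show "decidable (Suc 2) (\<lambda>ys. tl ys ! 1 = 0 \<or> tl ys ! 0 < Suc (ys ! 0) * tl ys ! 1)"
      by (intro computability_intros) auto
    show "\<exists>q. xs ! 1 = 0 \<or> xs ! 0 < Suc q * xs ! 1" for xs :: "nat list"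
      by (rule exI[of _ "xs ! 0"]) (cases "xs ! 1"; simp)
  qed
  then show "computable 2 (\<lambda>xs. xs ! 0 div xs ! 1)"
  proof (rule computable_cong)
    have "(LEAST q. b = 0 \<or> a < Suc q * b) = a div b" for a b :: nat
    proof (cases "b = 0")
      case False
      then have "b = 0 \<or> a < Suc q * b \<longleftrightarrow> a div b \<le> q" for q
        by (metis div_less_iff_less_mult less_Suc_eq_le neq0_conv)
      then show ?thesis by (simp add: Least_equality)
    qed (simp add: Least_equality)
    then show "(LEAST q. xs ! 1 = 0 \<or> xs ! 0 < Suc q * xs ! 1) = xs ! 0 div xs ! 1" for xs .
  qed
qed

lemma computable_mod:
  assumes "computable k a" "computable k b"
  shows "computable k (\<lambda>xs. a xs mod b xs)"
  using computable_diff[OF assms(1) computable_mult[OF assms(2) computable_div[OF assms]]]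
  by (simp add: minus_mult_div_eq_mod)

lemma decidable_odd: "computable k a \<Longrightarrow> decidable k (\<lambda>xs. odd (a xs))"
  using decidable_eq[OF computable_mod[OF _ computable_const[of _ 2]] computable_const[of _ 1]]
  by (simp add: odd_iff_mod_2_eq_one)

lemma computable_triangle:
  assumes "computable k a"
  shows "computable k (\<lambda>xs. triangle (a xs))"
  unfolding triangle_def using assms by (intro computability_intros computable_div)

lemma computable_prod_encode:
  assumes "computable k a" "computable k b"
  shows "computable k (\<lambda>xs. prod_encode (a xs, b xs))"
  unfolding prod_encode_def using assms by (auto intro!: computable_add computable_triangle)

lemma computable_fst_prod_decode:
  assumes "computable k a"
  shows "computable k (\<lambda>xs. fst (prod_decode (a xs)))"
proof (rule computable_comp1[OF _ assms])
  \<comment> \<open>A component of a pair is at most the code of the pair, which bounds the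
    quantifier over the other component.\<close>
  have "computable 1 (\<lambda>xs. LEAST m. \<exists>n<Suc (xs ! 0). prod_encode (m, n) = xs ! 0)"
  proof (rule computable_Least)
    show "decidable (Suc 1) (\<lambda>ys. \<exists>n<Suc (tl ys ! 0). prod_encode (ys ! 0, n) = tl ys ! 0)"
      by (intro computability_intros computable_prod_encode) auto
    show "\<exists>m. \<exists>n<Suc (xs ! 0). prod_encode (m, n) = xs ! 0" for xs :: "nat list"
      by (metis le_imp_less_Suc le_prod_encode_2 prod.collapse prod_decode_inverse)
  qed
  then show "computable 1 (\<lambda>xs. fst (prod_decode (xs ! 0)))"
  proof (rule computable_cong)
    have "(LEAST m. \<exists>n<Suc p. prod_encode (m, n) = p) = fst (prod_decode p)" for p
    proof (rule Least_equality)
      show "\<exists>n<Suc p. prod_encode (fst (prod_decode p), n) = p"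
        by (metis le_imp_less_Suc le_prod_encode_2 prod.collapse prod_decode_inverse)
    qed auto
    then show "(LEAST m. \<exists>n<Suc (xs ! 0). prod_encode (m, n) = xs ! 0) = fst (prod_decode (xs ! 0))" for xs .
  qed
qed

lemma computable_snd_prod_decode:
  assumes "computable k a"
  shows "computable k (\<lambda>xs. snd (prod_decode (a xs)))"
proof (rule computable_comp1[OF _ assms])
  have "computable 1 (\<lambda>xs. LEAST n. prod_encode (fst (prod_decode (xs ! 0)), n) = xs ! 0)"
  proof (rule computable_Least)
    show "decidable (Suc 1) (\<lambda>ys. prod_encode (fst (prod_decode (tl ys ! 0)), ys ! 0) = tl ys ! 0)"
      by (intro computability_intros computable_prod_encode computable_fst_prod_decode) auto
    show "\<exists>n. prod_encode (fst (prod_decode (xs ! 0)), n) = xs ! 0" for xs :: "nat list"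
      by (metis prod.collapse prod_decode_inverse)
  qed
  then show "computable 1 (\<lambda>xs. snd (prod_decode (xs ! 0)))"
  proof (rule computable_cong)
    have "(LEAST n. prod_encode (fst (prod_decode p), n) = p) = snd (prod_decode p)" for p
      by (rule Least_equality) (auto, metis order_refl prod_encode_inverse snd_conv)
    then show "(LEAST n. prod_encode (fst (prod_decode (xs ! 0)), n) = xs ! 0) = snd (prod_decode (xs ! 0))" for xs .
  qed
qed

section \<open>Representations by centers\<close>

text \<open>This is what clause (ii) demands of the types when the right end of an interval of type
  \<open>s\<close> is the center of one of type \<open>t\<close>. As the lengths agree, the left end
  of the second is then the center of the first.\<close>

definition tie :: "itype \<Rightarrow> itype \<Rightarrow> bool" where
  "tie s t \<longleftrightarrow> (ends_open s \<or> center_open t) \<and> (ends_open t \<or> center_open s)"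

text \<open>Here \<open>h\<close> is half the common length. The type of the centers is left open
  because real centers are later traded for natural numbers.\<close>

definition center_rep ::
  "itype set \<Rightarrow> 'a set \<Rightarrow> 'a rel \<Rightarrow> 'b::{plus,ord} \<Rightarrow> ('a \<Rightarrow> 'b) \<Rightarrow> ('a \<Rightarrow> itype) \<Rightarrow> bool" where
  "center_rep S X r h c T \<longleftrightarrow> (\<forall>x\<in>X. T x \<in> S) \<and>
     (\<forall>x\<in>X. \<forall>y\<in>X. (x, y) \<in> r \<longleftrightarrow> c x + h < c y \<or> (c x + h = c y \<and> tie (T x) (T y)))"

lemma center_rep_imp_representation:
  fixes c :: "'a \<Rightarrow> real"
  assumes "h > 0" "center_rep S X r h c T"
  shows "representation S X r (\<lambda>x. Interval (c x - h) (c x + h) (T x))"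
proof -
  have "\<exists>l>0. \<forall>x\<in>X. right_end (Interval (c x - h) (c x + h) (T x)) -
      left_end (Interval (c x - h) (c x + h) (T x)) = l"
    using assms(1) by (intro exI[of _ "2 * h"]) auto
  with assms(2) show ?thesis
    unfolding representation_def center_rep_def interval_less_def center_def tie_def by auto
qed

lemma representation_imp_center_rep:
  assumes "representation S X r I"
  obtains h where "h > 0" "center_rep S X r h (\<lambda>x. center (I x)) (\<lambda>x. kind (I x))"
proof -
  obtain l where l: "l > 0" "\<And>x. x \<in> X \<Longrightarrow> right_end (I x) - left_end (I x) = l"
    using assms unfolding representation_def by auto
  have "right_end (I x) = center (I x) + l / 2" if "x \<in> X" for x
    using l(2)[OF that] by (simp add: center_def field_simps)
  then have "center_rep S X r (l / 2) (\<lambda>x. center (I x)) (\<lambda>x. kind (I x))"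
    using assms unfolding representation_def center_rep_def interval_less_def tie_def by auto
  with l(1) show thesis by (intro that[of "l / 2"]) auto
qed

section \<open>Forcing walks and potentials\<close>

definition step :: "'a set \<Rightarrow> 'a rel \<Rightarrow> 'a \<Rightarrow> 'a \<Rightarrow> bool" where
  "step X r x y \<longleftrightarrow> x \<in> X \<and> y \<in> X \<and> ((x, y) \<in> r \<or> incomparable r x y)"

text \<open>Meant for steps only, where an unrelated pair is incomparable.\<close>

definition weight :: "'a rel \<Rightarrow> 'a \<Rightarrow> 'a \<Rightarrow> int" where
  "weight r x y = (if (x, y) \<in> r then 1 else - 1)"

fun walk :: "'a set \<Rightarrow> 'a rel \<Rightarrow> 'a \<Rightarrow> 'a list \<Rightarrow> 'a \<Rightarrow> bool" where
  "walk X r u [] v \<longleftrightarrow> u \<in> X \<and> u = v"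
| "walk X r u (x # xs) v \<longleftrightarrow> step X r u x \<and> walk X r x xs v"

fun walk_value :: "'a rel \<Rightarrow> 'a \<Rightarrow> 'a list \<Rightarrow> int" where
  "walk_value r u [] = 0"
| "walk_value r u (x # xs) = weight r u x + walk_value r x xs"

lemma walk_append: "walk X r u (xs @ ys) v \<longleftrightarrow> (\<exists>w. walk X r u xs w \<and> walk X r w ys v)"
proof (induction xs arbitrary: u)
  case Nil
  then show ?case by (cases ys) (auto simp: step_def)
qed auto

lemma walk_value_append:
  "walk X r u xs w \<Longrightarrow> walk_value r u (xs @ ys) = walk_value r u xs + walk_value r w ys"
  by (induction xs arbitrary: u) auto

lemma walk_subset:
  "walk X r u xs v \<Longrightarrow> insert u (insert v (set xs)) \<subseteq> X"
  by (induction xs arbitrary: u) (auto simp: step_def)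

lemma walk_last: "walk X r u xs v \<Longrightarrow> last (u # xs) = v"
  by (induction xs arbitrary: u) auto

lemma walk_restrict:
  "walk X r u xs v \<Longrightarrow> insert u (set xs) \<subseteq> Y \<Longrightarrow> walk Y r u xs v"
  by (induction xs arbitrary: u) (auto simp: step_def)

lemma walk_split:
  assumes "walk X r u xs v" "z \<in> insert u (set xs)"
  shows "\<exists>ys zs. xs = ys @ zs \<and> walk X r u ys z \<and> walk X r z zs v"
proof (cases "z = u")
  case True
  then show ?thesis using assms walk_subset[OF assms(1)] by (intro exI[of _ "[]"] exI[of _ xs]) auto
next
  case False
  then have "z \<in> set xs" using assms(2) by simp
  then obtain ys zs where "xs = (ys @ [z]) @ zs" by (metis append.assoc append_Cons append_Nil split_list)
  moreover from this assms(1) obtain w where "walk X r u (ys @ [z]) w" "walk X r w zs v"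
    by (auto simp only: walk_append)
  moreover from this(1) have "w = z" using walk_last by fastforce
  ultimately show ?thesis by blast
qed

lemma walk_steps:
  "walk X r u xs v \<Longrightarrow> i < length xs \<Longrightarrow> step X r ((u # xs) ! i) (xs ! i)"
proof (induction xs arbitrary: u i)
  case (Cons x xs)
  then show ?case by (cases i) auto
qed simp

lemma walk_value_eq_sum:
  "walk_value r u xs = (\<Sum>i<length xs. weight r ((u # xs) ! i) (xs ! i))"
  by (induction xs arbitrary: u) (auto simp: sum.lessThan_Suc_shift simp del: sum.lessThan_Suc)

lemma walk_forcing_cycle:
  assumes "walk X r u xs u" "xs \<noteq> []"
  shows "forcing_cycle X r (u # xs)"
  using assms walk_subset[OF assms(1)] walk_last[OF assms(1)] walk_steps[OF assms(1)]
  unfolding forcing_cycle_def step_def by (auto simp: Suc_le_eq)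

lemma cycle_value_walk:
  assumes "walk X r u xs v"
  shows "cycle_value r (u # xs) = walk_value r u xs"
proof -
  let ?R = "{i. i < length xs \<and> ((u # xs) ! i, xs ! i) \<in> r}"
  let ?I = "{i. i < length xs \<and> incomparable r ((u # xs) ! i) (xs ! i)}"
  have "walk_value r u xs = (\<Sum>i\<in>?R \<union> ?I. weight r ((u # xs) ! i) (xs ! i))"
    unfolding walk_value_eq_sum using walk_steps[OF assms]
    by (intro sum.cong) (auto simp: step_def)
  also have "\<dots> = (\<Sum>i\<in>?R. weight r ((u # xs) ! i) (xs ! i)) + (\<Sum>i\<in>?I. weight r ((u # xs) ! i) (xs ! i))"
    by (intro sum.union_disjoint) (auto simp: incomparable_def)
  also have "(\<Sum>i\<in>?R. weight r ((u # xs) ! i) (xs ! i)) = (\<Sum>i\<in>?R. 1)"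
    by (intro sum.cong) (auto simp: weight_def)
  also have "(\<Sum>i\<in>?I. weight r ((u # xs) ! i) (xs ! i)) = (\<Sum>i\<in>?I. - 1)"
    by (intro sum.cong) (auto simp: weight_def incomparable_def)
  finally show ?thesis
    unfolding cycle_value_def by simp
qed

text \<open>Let \<open>W\<close> be the set of vertices reachable from \<open>u\<close>. No step
  leads from \<open>W\<close> to a vertex outside, so such a vertex is neither above nor
  incomparable to any element of \<open>W\<close>, hence below all of it. If \<open>W\<close> were
  not \<open>X\<close>, then \<open>X - W\<close> and \<open>W\<close> would separate
  \<open>X\<close>.\<close>

lemma inseparable_imp_walk:
  assumes "inseparable X r" "u \<in> X" "v \<in> X"
  shows "\<exists>xs. walk X r u xs v"
proof (rule ccontr)
  assume no: "\<nexists>xs. walk X r u xs v"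
  define W where "W = {w. \<exists>xs. walk X r u xs w}"
  have "W \<subseteq> X" using walk_subset unfolding W_def by fastforce
  have "walk X r u [] u" using assms by simp
  then have "u \<in> W" unfolding W_def by blast
  have "(x, w) \<in> r" if "x \<in> X - W" "w \<in> W" for x w
  proof (rule ccontr)
    assume "(x, w) \<notin> r"
    with that \<open>W \<subseteq> X\<close> have "step X r w x"
      by (auto simp: step_def incomparable_def)
    moreover obtain xs where "walk X r u xs w" using \<open>w \<in> W\<close> unfolding W_def by blast
    ultimately have "walk X r u (xs @ [x]) x"
      using that by (auto simp: walk_append)
    then show False using that W_def by blast
  qed
  then have "separable X r"
    unfolding separable_def
    using no assms \<open>u \<in> W\<close> \<open>W \<subseteq> X\<close> by (intro exI[of _ "X - W"] exI[of _ W]) (auto simp: W_def)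
  then show False using assms unfolding inseparable_def by simp
qed

lemma bounded_int_set_has_max:
  fixes A :: "int set"
  assumes "a \<in> A" "\<And>x. x \<in> A \<Longrightarrow> x \<le> b"
  shows "\<exists>m\<in>A. \<forall>x\<in>A. x \<le> m"
proof -
  obtain m where m: "m \<in> A" "\<And>x. x \<in> A \<Longrightarrow> nat (b - m) \<le> nat (b - x)"
    using ex_has_least_nat[of "\<lambda>x. x \<in> A" a "\<lambda>x. nat (b - x)"] assms(1) by blast
  have "x \<le> m" if "x \<in> A" for x
    using m(2)[OF that] assms(2)[OF that] assms(2)[OF m(1)] by simp
  then show ?thesis using m(1) by blast
qed

section \<open>Maximal walk values and the classes of zero-value cycles\<close>

locale no_positive_cycle =
  fixes X :: "'a set" and r :: "'a rel"
  assumes finite: "finite X"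
    and connected: "\<And>u v. u \<in> X \<Longrightarrow> v \<in> X \<Longrightarrow> \<exists>xs. walk X r u xs v"
    and nonpositive: "\<And>u xs. walk X r u xs u \<Longrightarrow> walk_value r u xs \<le> 0"
begin

definition max_value :: "'a \<Rightarrow> 'a \<Rightarrow> int" where
  "max_value u v = (SOME m. (\<exists>xs. walk X r u xs v \<and> walk_value r u xs = m) \<and>
     (\<forall>xs. walk X r u xs v \<longrightarrow> walk_value r u xs \<le> m))"

text \<open>A fixed return walk from \<open>v\<close> to \<open>u\<close> closes every walk from
  \<open>u\<close> to \<open>v\<close>. Closed walks have value at most 0, so minus the value of the
  return walk bounds all values, and a bounded nonempty set of integers has a maximum.\<close>

lemma max_value_spec:
  assumes "u \<in> X" "v \<in> X"
  shows "(\<exists>xs. walk X r u xs v \<and> walk_value r u xs = max_value u v) \<and>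
     (\<forall>xs. walk X r u xs v \<longrightarrow> walk_value r u xs \<le> max_value u v)"
proof -
  obtain xs where xs: "walk X r u xs v" using connected assms by blast
  obtain zs where zs: "walk X r v zs u" using connected assms by blast
  let ?A = "{walk_value r u ys |ys. walk X r u ys v}"
  have "\<exists>m\<in>?A. \<forall>x\<in>?A. x \<le> m"
  proof (rule bounded_int_set_has_max)
    show "walk_value r u xs \<in> ?A" using xs by blast
    show "x \<le> - walk_value r v zs" if "x \<in> ?A" for x
    proof -
      obtain ys where ys: "x = walk_value r u ys" "walk X r u ys v" using \<open>x \<in> ?A\<close> by blast
      with zs have "walk X r u (ys @ zs) u" by (auto simp: walk_append)
      from nonpositive[OF this] show ?thesis using ys walk_value_append[OF ys(2)] by simp
    qed
  qed
  then have "\<exists>m. (\<exists>xs. walk X r u xs v \<and> walk_value r u xs = m) \<and>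
     (\<forall>xs. walk X r u xs v \<longrightarrow> walk_value r u xs \<le> m)" by blast
  then show ?thesis unfolding max_value_def by (rule someI_ex)
qed

lemma max_value_attained:
  assumes "u \<in> X" "v \<in> X"
  obtains xs where "walk X r u xs v" "walk_value r u xs = max_value u v"
  using max_value_spec[OF assms] by blast

lemma walk_value_le_max_value: "walk X r u xs v \<Longrightarrow> walk_value r u xs \<le> max_value u v"
  using max_value_spec[of u v] walk_subset[of X r u xs v] by auto

lemma max_value_triangle:
  assumes "u \<in> X" "v \<in> X" "w \<in> X"
  shows "max_value u v + max_value v w \<le> max_value u w"
proof -
  obtain xs where xs: "walk X r u xs v" "walk_value r u xs = max_value u v"
    using max_value_attained assms by blast
  obtain ys where ys: "walk X r v ys w" "walk_value r v ys = max_value v w"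
    using max_value_attained assms by blast
  have "walk X r u (xs @ ys) w" using xs ys by (auto simp: walk_append)
  from walk_value_le_max_value[OF this] show ?thesis
    using xs ys walk_value_append[OF xs(1)] by simp
qed

lemma max_value_self: "u \<in> X \<Longrightarrow> max_value u u = 0"
  using walk_value_le_max_value[of u "[]" u] max_value_attained[of u u] nonpositive[of u]
  by (metis antisym walk.simps(1) walk_value.simps(1))

lemma max_value_roundtrip: "u \<in> X \<Longrightarrow> v \<in> X \<Longrightarrow> max_value u v + max_value v u \<le> 0"
  using max_value_triangle[of u v u] max_value_self[of u] by simp

lemma weight_le_max_value: "step X r x y \<Longrightarrow> weight r x y \<le> max_value x y"
  using walk_value_le_max_value[of x "[y]" y] by (simp add: step_def)

text \<open>The vertices that share a closed walk of value 0 with \<open>x\<close>: optimal walks to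
  \<open>y\<close> and back together have value 0.\<close>

definition tight_class :: "'a \<Rightarrow> 'a set" where
  "tight_class x = {y \<in> X. max_value x y + max_value y x = 0}"

lemma tight_class_self: "x \<in> X \<Longrightarrow> x \<in> tight_class x"
  by (simp add: tight_class_def max_value_self)

lemma tight_class_eq:
  assumes "x \<in> X" "y \<in> tight_class x"
  shows "tight_class y = tight_class x"
proof -
  have sub: "tight_class b \<subseteq> tight_class a" if "a \<in> X" "b \<in> tight_class a" for a b
  proof
    fix z assume z: "z \<in> tight_class b"
    then show "z \<in> tight_class a"
      using that max_value_triangle[of a b z] max_value_triangle[of z b a] max_value_roundtrip[of a z]
      unfolding tight_class_def by auto
  qed
  have "x \<in> tight_class y" "y \<in> X" using assms unfolding tight_class_def by (auto simp: add.commute)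
  then show ?thesis using sub assms by blast
qed

text \<open>An optimal return from \<open>v\<close> to \<open>u\<close> completes the walk to a
  closed one of value 0. Cut at a vertex \<open>z\<close>, its two parts are bounded by the maximal
  values from \<open>u\<close> to \<open>z\<close> and from \<open>z\<close> to \<open>u\<close>,
  whose sum is at most 0; so that sum is 0.\<close>

lemma walk_in_tight_class:
  assumes "walk X r u xs v" "walk_value r u xs + max_value v u = 0"
  shows "insert u (set xs) \<subseteq> tight_class u"
proof
  fix z assume "z \<in> insert u (set xs)"
  from walk_split[OF assms(1) this] obtain ys zs where
    *: "xs = ys @ zs" "walk X r u ys z" "walk X r z zs v" by blast
  have X: "u \<in> X" "v \<in> X" "z \<in> X" using * walk_subset by fastforce+
  have "walk_value r u xs = walk_value r u ys + walk_value r z zs"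
    using * walk_value_append by metis
  then show "z \<in> tight_class u"
    using assms(2) X max_value_roundtrip[of u z] walk_value_le_max_value[OF *(2)]
      walk_value_le_max_value[OF *(3)] max_value_triangle[of z v u]
    unfolding tight_class_def by auto
qed

text \<open>For each \<open>a\<close> in the class, an optimal walk from \<open>u\<close> to
  \<open>a\<close> and an optimal walk back make an excursion of value 0. Concatenating these
  excursions visits the whole class, and a closed walk of value 0 cannot leave it.\<close>

lemma tight_class_closed_walk:
  assumes "u \<in> X"
  obtains xs where "walk X r u xs u" "walk_value r u xs = 0" "insert u (set xs) = tight_class u"
proof -
  have "\<exists>xs. walk X r u xs u \<and> walk_value r u xs = 0 \<and> A \<subseteq> insert u (set xs)"
    if "finite A" "A \<subseteq> tight_class u" for A
    using that
  proof (induction A rule: finite_induct)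
    case empty
    show ?case using assms by (intro exI[of _ "[]"]) auto
  next
    case (insert a A)
    then obtain xs where xs: "walk X r u xs u" "walk_value r u xs = 0" "A \<subseteq> insert u (set xs)" by auto
    have a: "a \<in> X" "max_value u a + max_value a u = 0"
      using insert.prems unfolding tight_class_def by auto
    obtain ys where ys: "walk X r u ys a" "walk_value r u ys = max_value u a"
      using max_value_attained a assms by blast
    obtain zs where zs: "walk X r a zs u" "walk_value r a zs = max_value a u"
      using max_value_attained a assms by blast
    have "walk X r u (xs @ ys @ zs) u" using xs ys zs by (auto simp: walk_append)
    moreover have "walk_value r u (xs @ ys @ zs) = 0"
      using walk_value_append[OF xs(1)] walk_value_append[OF ys(1)] xs ys zs a by simp
    moreover have "a \<in> insert u (set ys)"
      using walk_last[OF ys(1)] by (cases ys) (auto split: if_splits)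
    ultimately show ?case using xs(3) by (intro exI[of _ "xs @ ys @ zs"]) auto
  qed
  moreover have "finite (tight_class u)" using finite unfolding tight_class_def by simp
  ultimately obtain xs where xs: "walk X r u xs u" "walk_value r u xs = 0"
    "tight_class u \<subseteq> insert u (set xs)" by blast
  then have "insert u (set xs) \<subseteq> tight_class u"
    using walk_in_tight_class[OF xs(1)] max_value_self[OF assms] by simp
  then show thesis using that xs by blast
qed

text \<open>A single source \<open>u\<close> already satisfies all step inequalities with
  half-length 1. In the sum over all sources a step is tight only if it is tight for every
  source.\<close>

definition potential :: "'a \<Rightarrow> int" where
  "potential v = (\<Sum>u\<in>X. max_value u v)"

lemma max_value_step: "u \<in> X \<Longrightarrow> step X r x y \<Longrightarrow> max_value u x + weight r x y \<le> max_value u y"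
  using max_value_triangle[of u x y] weight_le_max_value[of x y] by (simp add: step_def)

lemma potential_step:
  assumes "step X r x y"
  shows "potential x + int (card X) * weight r x y \<le> potential y"
proof -
  have "potential x + int (card X) * weight r x y = (\<Sum>u\<in>X. max_value u x + weight r x y)"
    unfolding potential_def by (simp add: sum.distrib)
  also have "\<dots> \<le> potential y"
    unfolding potential_def using assms by (intro sum_mono max_value_step) auto
  finally show ?thesis .
qed

lemma potential_tight:
  assumes "step X r x y" "potential x + int (card X) * weight r x y = potential y"
  shows "max_value y x + weight r x y = 0"
proof (rule ccontr)
  assume ne: "max_value y x + weight r x y \<noteq> 0"
  have y: "y \<in> X" using assms(1) by (simp add: step_def)
  have "potential x + int (card X) * weight r x y = (\<Sum>u\<in>X. max_value u x + weight r x y)"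
    unfolding potential_def by (simp add: sum.distrib)
  also have "\<dots> < potential y"
    unfolding potential_def
  proof (rule sum_strict_mono_ex1)
    show "\<exists>u\<in>X. max_value u x + weight r x y < max_value u y"
      \<comment> \<open>For the source \<open>y\<close> the right-hand side is
        \<open>max_value y y = 0\<close>, so \<open>ne\<close> makes this inequality strict.\<close>
      using ne y max_value_self[OF y] max_value_step[OF y assms(1)] by (intro bexI[of _ y]) auto
  qed (use finite assms(1) max_value_step in auto)
  finally show False using assms(2) by simp
qed

end

section \<open>Gluing representations of the tight classes\<close>

lemma center_rep_walk:
  fixes c :: "'a \<Rightarrow> real"
  assumes "center_rep S X r h c T" "h > 0" "walk X r u xs v"
  shows "c u + h * of_int (walk_value r u xs) \<le> c v"
  using assms(3)
proof (induction xs arbitrary: u)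
  case (Cons x xs)
  have "u \<in> X" "x \<in> X" "(u, x) \<in> r \<or> (x, u) \<notin> r"
    using Cons.prems by (auto simp: step_def incomparable_def)
  \<comment> \<open>A related step raises the center by at least \<open>h\<close>, an incomparable
    one lowers it by at most \<open>h\<close>.\<close>
  then have "c u + h * of_int (weight r u x) \<le> c x"
    using assms(1) unfolding center_rep_def weight_def by (force simp: not_less)
  moreover have "c x + h * of_int (walk_value r x xs) \<le> c v" using Cons by simp
  ultimately show ?case by (simp add: algebra_simps)
qed simp

context no_positive_cycle
begin

lemma tight_step_in_class:
  assumes "step X r x y" "max_value y x + weight r x y = 0"
  shows "y \<in> tight_class x"
  using assms max_value_roundtrip[of x y] weight_le_max_value[OF assms(1)]
  unfolding tight_class_def step_def by auto

text \<open>An optimal walk from \<open>y\<close> back to \<open>x\<close> has value minus the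
  weight of the step. The center inequalities along the step and along this walk are opposite, so
  both are equalities.\<close>

lemma center_rep_tight_step:
  fixes c :: "'a \<Rightarrow> real"
  assumes "step X r x y" "max_value y x + weight r x y = 0"
    and rep: "center_rep S (tight_class x) r h c T" "h > 0"
  shows "c y = c x + h * of_int (weight r x y)"
proof -
  have X: "x \<in> X" "y \<in> X" using assms(1) by (auto simp: step_def)
  have y: "y \<in> tight_class x" using tight_step_in_class assms by blast
  \<comment> \<open>A walk that closes up to value 0 stays in its class, so a representation of the
    class alone controls it.\<close>
  have walk_le: "c a + h * of_int (walk_value r a xs) \<le> c b"
    if "walk X r a xs b" "walk_value r a xs + max_value b a = 0" "a \<in> tight_class x" for a b xs
  proof (rule center_rep_walk[OF rep])
    show "walk (tight_class x) r a xs b"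
      using walk_restrict[OF that(1) walk_in_tight_class[OF that(1,2)]] tight_class_eq[OF X(1) that(3)]
      by simp
  qed
  obtain xs where xs: "walk X r y xs x" "walk_value r y xs = max_value y x"
    using max_value_attained X by blast
  have "max_value x y = weight r x y"
    using weight_le_max_value[OF assms(1)] assms(2) max_value_roundtrip[OF X] by simp
  then have "c y + h * of_int (walk_value r y xs) \<le> c x"
    using xs assms(2) y by (intro walk_le) auto
  moreover have "c x + h * of_int (walk_value r x [y]) \<le> c y"
    using assms X tight_class_self by (intro walk_le) auto
  moreover have "walk_value r y xs = - weight r x y" using xs assms(2) by simp
  ultimately show ?thesis by simp
qed

text \<open>The centers come from \<open>potential\<close>; the class representations supply only
  the types. Types matter only on tight steps. Such a step stays in one class and is tight in the
  representation of that class too, where its types decide correctly.\<close>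

lemma class_reps_imp_representation:
  assumes reps: "\<And>x. x \<in> X \<Longrightarrow> \<exists>I. representation S (tight_class x) r I"
  shows "\<exists>I. representation S X r I"
proof (cases "X = {}")
  case True
  then show ?thesis by (auto simp: representation_def intro: exI[of _ "1::real"])
next
  case False
  have "\<exists>p. \<exists>h>0. center_rep S (tight_class x) r h (fst p :: 'a \<Rightarrow> real) (snd p)" if x: "x \<in> X" for x
  proof -
    obtain I where "representation S (tight_class x) r I" using reps[OF x] by blast
    then obtain h where "h > 0" "center_rep S (tight_class x) r h (\<lambda>x. center (I x)) (\<lambda>x. kind (I x))"
      by (rule representation_imp_center_rep)
    then show ?thesis by (intro exI[of _ "(\<lambda>x. center (I x), \<lambda>x. kind (I x))"]) auto
  qed
  \<comment> \<open>The choice is made per class and not per element, so that all members of a class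
    take their types from the same representation.\<close>
  then have "\<forall>K\<in>tight_class ` X. \<exists>p. \<exists>h>0. center_rep S K r h (fst p :: 'a \<Rightarrow> real) (snd p)" by blast
  then obtain p where p: "\<And>x. x \<in> X \<Longrightarrow>
      \<exists>h>0. center_rep S (tight_class x) r h (fst (p (tight_class x)) :: 'a \<Rightarrow> real) (snd (p (tight_class x)))"
    by (metis imageI)
  define T where "T x = snd (p (tight_class x)) x" for x
  have TS: "T x \<in> S" if "x \<in> X" for x
    using p[OF that] tight_class_self[OF that] unfolding T_def center_rep_def by blast
  have tight: "((x, y) \<in> r \<longrightarrow> tie (T x) (T y)) \<and> ((x, y) \<notin> r \<longrightarrow> \<not> tie (T y) (T x))"
    if step: "step X r x y" and eq: "potential x + int (card X) * weight r x y = potential y" for x y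
  proof -
    have X: "x \<in> X" "y \<in> X" using step by (auto simp: step_def)
    define c where "c = fst (p (tight_class x))"
    have zero: "max_value y x + weight r x y = 0" by (rule potential_tight[OF step eq])
    then have y: "y \<in> tight_class x" by (rule tight_step_in_class[OF step])
    have Ty: "T y = snd (p (tight_class x)) y"
      unfolding T_def using tight_class_eq[OF X(1) y] by simp
    obtain h where h: "h > 0" "center_rep S (tight_class x) r h c (snd (p (tight_class x)))"
      using p[OF X(1)] c_def by blast
    have cy: "c y = c x + h * of_int (weight r x y)"
      by (rule center_rep_tight_step[OF step zero h(2,1)])
    \<comment> \<open>Both orders of the pair are needed: a tight related step is read from
      \<open>x\<close> to \<open>y\<close>, a tight incomparable one from \<open>y\<close> to
      \<open>x\<close>.\<close>
    have less: "(a, b) \<in> r \<longleftrightarrow> c a + h < c b \<or> (c a + h = c b \<and> tie (T a) (T b))"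
      if "{a, b} = {x, y}" for a b
    proof -
      have "a \<in> tight_class x" "b \<in> tight_class x" "T a = snd (p (tight_class x)) a"
        "T b = snd (p (tight_class x)) b"
        using that y Ty tight_class_self[OF X(1)] by (auto simp: doubleton_eq_iff T_def)
      then show ?thesis using h(2) unfolding center_rep_def by auto
    qed
    show ?thesis
    proof (cases "(x, y) \<in> r")
      case True
      then have "\<not> c x + h < c y" using cy by (simp add: weight_def)
      then show ?thesis using True less[of x y] by blast
    next
      case False
      then have "(y, x) \<notin> r" "c y + h = c x"
        using step cy by (auto simp: step_def incomparable_def weight_def)
      then show ?thesis using False less[of y x] by blast
    qed
  qed
  have pos: "card X > 0" using False finite by (simp add: card_gt_0_iff)
  have "(x, y) \<in> r \<longleftrightarrow> potential x + int (card X) < potential y \<or>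
      (potential x + int (card X) = potential y \<and> tie (T x) (T y))" if "x \<in> X" "y \<in> X" for x y
  proof (cases "(x, y) \<in> r")
    case True
    then have "step X r x y" "weight r x y = 1" using that by (auto simp: step_def weight_def)
    then show ?thesis using True tight[of x y] potential_step[of x y] by auto
  next
    case nr: False
    consider "x = y" | "(y, x) \<in> r" | "incomparable r y x"
      using nr by (auto simp: incomparable_def)
    then show ?thesis
    proof cases
      case 1
      then show ?thesis using nr pos by simp
    next
      case 2
      then have "step X r y x" "weight r y x = 1" using that by (auto simp: step_def weight_def)
      then show ?thesis using nr potential_step[of y x] pos by auto
    next
      case 3
      \<comment> \<open>Read from \<open>y\<close> to \<open>x\<close>, incomparability bounds
        \<open>potential y\<close> by \<open>potential x + int (card X)\<close>; at equality
        \<open>tight\<close> excludes a tie.\<close>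
      then have "step X r y x" "weight r y x = - 1" "(y, x) \<notin> r"
        using that by (auto simp: step_def weight_def incomparable_def)
      then show ?thesis using nr tight[of y x] potential_step[of y x] by auto
    qed
  qed
  moreover have "real_of_int a + real n < real_of_int b \<longleftrightarrow> a + int n < b"
    "real_of_int a + real n = real_of_int b \<longleftrightarrow> a + int n = b" for a b n
    by linarith+
  ultimately have "center_rep S X r (real (card X)) (\<lambda>x. real_of_int (potential x)) T"
    unfolding center_rep_def using TS by blast
  then show ?thesis
    using center_rep_imp_representation pos by (metis of_nat_0_less_iff)
qed

end

lemma representation_Restr: "representation S X (Restr r X) I \<longleftrightarrow> representation S X r I"
  unfolding representation_def by auto

lemma representation_or_certificate:
  assumes "finite X" "inseparable X r" "S \<noteq> {}"
  shows "(\<exists>I. representation S X r I) \<or> (\<exists>xs. certificate S X r xs)"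
proof (rule ccontr)
  assume neg: "\<not> ?thesis"
  interpret no_positive_cycle X r
  proof
    show "finite X" by fact
    show "\<exists>xs. walk X r u xs v" if "u \<in> X" "v \<in> X" for u v
      using inseparable_imp_walk assms(2) that by metis
    show "walk_value r u xs \<le> 0" if w: "walk X r u xs u" for u xs
    proof (rule ccontr)
      assume pos: "\<not> ?thesis"
      then have "xs \<noteq> []" by auto
      then have "forcing_cycle X r (u # xs)" by (rule walk_forcing_cycle[OF w])
      then show False using neg pos cycle_value_walk[OF w] unfolding certificate_def by auto
    qed
  qed
  have "\<exists>I. representation S (tight_class x) r I" if x: "x \<in> X" for x
  proof -
    obtain xs where xs: "walk X r x xs x" "walk_value r x xs = 0" "insert x (set xs) = tight_class x"
      using tight_class_closed_walk[OF x] by blast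
    show ?thesis
    proof (cases "xs = []")
      case True
      \<comment> \<open>The class is \<open>{x}\<close> here, and the empty walk is no forcing
        cycle; a single interval of any admissible type represents it.\<close>
      obtain t where t: "t \<in> S" using assms by blast
      \<comment> \<open>A loop at \<open>x\<close> would be a closed walk of value 1.\<close>
      have "(x, x) \<notin> r"
        using nonpositive[of x "[x]"] x by (auto simp: step_def weight_def)
      moreover have "tight_class x = {x}" using xs(3) True by simp
      ultimately have "center_rep S (tight_class x) r 1 (\<lambda>_. 0::real) (\<lambda>_. t)"
        using t by (simp add: center_rep_def)
      then show ?thesis using center_rep_imp_representation zero_less_one by blast
    next
      case False
      then have "forcing_cycle X r (x # xs)" "cycle_value r (x # xs) = 0"
        using walk_forcing_cycle cycle_value_walk xs by metis+
      then have "\<exists>I. representation S (set (x # xs)) (Restr r (set (x # xs))) I"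
        using neg unfolding certificate_def by blast
      then show ?thesis using xs(3) unfolding representation_Restr by simp
    qed
  qed
  then show False using class_reps_imp_representation neg by blast
qed

section \<open>Bounded integer representations\<close>

lemma lex_less_nat:
  fixes a b p q N :: nat
  assumes "p < N" "q < N"
  shows "a * N + p < b * N + q \<longleftrightarrow> a < b \<or> (a = b \<and> p < q)"
proof -
  consider "a < b" | "a = b" | "b < a" by linarith
  then show ?thesis
  proof cases
    case 1
    then have "Suc a * N \<le> b * N" by (intro mult_le_mono1) auto
    then show ?thesis using assms 1 by simp
  next
    case 3
    then have "Suc b * N \<le> a * N" by (intro mult_le_mono1) auto
    then show ?thesis using assms 3 by simp
  qed simp
qed

lemma less_iff_floor_frac:
  fixes x y :: real
  shows "x < y \<longleftrightarrow> \<lfloor>x\<rfloor> < \<lfloor>y\<rfloor> \<or> (\<lfloor>x\<rfloor> = \<lfloor>y\<rfloor> \<and> frac x < frac y)"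
  unfolding frac_def by linarith

text \<open>Whether two reals differ by less than, exactly, or more than 1 depends only on their
  integer parts and on the order of their fractional parts, so the latter may be replaced by ranks.\<close>

lemma center_rep_real_to_nat:
  fixes c :: "'a \<Rightarrow> real"
  assumes "finite X" "h > 0" "center_rep S X r h c T" "card X \<le> N"
  obtains c' :: "'a \<Rightarrow> nat" where "center_rep S X r N c' T"
proof -
  define d where "d x = c x / h" for x
  define rank where "rank x = card {y \<in> X. frac (d y) < frac (d x)}" for x
  \<comment> \<open>A common lower bound of the integer parts, subtracted to make them natural
    numbers.\<close>
  obtain b where b: "\<And>x. x \<in> X \<Longrightarrow> b \<le> \<lfloor>d x\<rfloor>"
    using assms(1) finite_imageI[of X "\<lambda>x. \<lfloor>d x\<rfloor>"] by (metis Min_le imageI)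
  define g where "g x = nat (\<lfloor>d x\<rfloor> - b)" for x
  have rank_less: "rank x < N" if "x \<in> X" for x
  proof -
    have "rank x < card X"
      unfolding rank_def using assms(1) that by (intro psubset_card_mono) auto
    then show ?thesis using assms(4) by simp
  qed
  have rank_mono: "rank x < rank y" if "frac (d x) < frac (d y)" "x \<in> X" for x y
    unfolding rank_def using assms(1) that by (intro psubset_card_mono psubsetI) auto
  have rank_iff: "rank x < rank y \<longleftrightarrow> frac (d x) < frac (d y)" if "x \<in> X" "y \<in> X" for x y
  proof (cases "frac (d x) = frac (d y)")
    case True
    then show ?thesis unfolding rank_def by simp
  next
    case False
    then show ?thesis using rank_mono that by (metis linorder_neq_iff order_less_asym)
  qed
  have floor_iff: "\<lfloor>d x\<rfloor> + 1 < \<lfloor>d y\<rfloor> \<longleftrightarrow> Suc (g x) < g y"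
    "\<lfloor>d y\<rfloor> < \<lfloor>d x\<rfloor> + 1 \<longleftrightarrow> g y < Suc (g x)"
    "\<lfloor>d x\<rfloor> + 1 = \<lfloor>d y\<rfloor> \<longleftrightarrow> Suc (g x) = g y"
    "\<lfloor>d y\<rfloor> = \<lfloor>d x\<rfloor> + 1 \<longleftrightarrow> g y = Suc (g x)"
    if "x \<in> X" "y \<in> X" for x y
    using b[OF that(1)] b[OF that(2)] unfolding g_def by auto
  \<comment> \<open>The rank is below \<open>N\<close> and serves as last digit in base
    \<open>N\<close>. Adding \<open>N\<close> to \<open>c'\<close> raises the shifted integer part
    by 1, as adding 1 to \<open>d\<close> does.\<close>
  define c' where "c' x = g x * N + rank x" for x
  have c': "c' x + N = Suc (g x) * N + rank x" for x by (simp add: c'_def)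
  have div: "c x + h < c y \<longleftrightarrow> d x + 1 < d y" "c y < c x + h \<longleftrightarrow> d y < d x + 1" for x y
  proof -
    have "c x + h = h * (d x + 1)" "c y = h * d y"
      using assms(2) by (simp_all add: d_def field_simps)
    then show "c x + h < c y \<longleftrightarrow> d x + 1 < d y" "c y < c x + h \<longleftrightarrow> d y < d x + 1"
      using assms(2) by (simp_all only: mult_less_cancel_left_pos)
  qed
  have less: "c x + h < c y \<longleftrightarrow> c' x + N < c' y" "c y < c x + h \<longleftrightarrow> c' y < c' x + N"
    if X: "x \<in> X" "y \<in> X" for x y
  proof -
    have plus1: "frac (d x + 1) = frac (d x)" "\<lfloor>d x + 1\<rfloor> = \<lfloor>d x\<rfloor> + 1"
      by (simp_all add: frac_def)
    show "c x + h < c y \<longleftrightarrow> c' x + N < c' y"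
      unfolding div less_iff_floor_frac[of "d x + 1"] plus1 c' c'_def[of y]
        lex_less_nat[OF rank_less[OF X(1)] rank_less[OF X(2)]]
      by (simp only: floor_iff[OF X] rank_iff[OF X])
    show "c y < c x + h \<longleftrightarrow> c' y < c' x + N"
      unfolding div less_iff_floor_frac[of _ "d x + 1"] plus1 c' c'_def[of y]
        lex_less_nat[OF rank_less[OF X(2)] rank_less[OF X(1)]]
      by (simp only: floor_iff[OF X] rank_iff[OF X(2,1)])
  qed
  have "c x + h = c y \<longleftrightarrow> c' x + N = c' y" if "x \<in> X" "y \<in> X" for x y
    using less[OF that] by (metis linorder_less_linear order_less_irrefl)
  with less assms(3) have "center_rep S X r N c' T"
    unfolding center_rep_def by simp
  then show thesis by (rule that)
qed

text \<open>In a representation with least sum of centers there is no gap longer than \<open>N + 1\<close>: everything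
  above such a gap could be moved down by 1.\<close>

lemma center_rep_nat_bounded:
  fixes c :: "'a \<Rightarrow> nat"
  assumes "finite X" "center_rep S X r N c T"
  obtains c' where "center_rep S X r N c' T" "\<And>x. x \<in> X \<Longrightarrow> c' x \<le> Suc N * card X"
proof -
  obtain c where c: "center_rep S X r N c T"
    and least: "\<And>d. center_rep S X r N d T \<Longrightarrow> sum c X \<le> sum d X"
    using ex_has_least_nat[of "\<lambda>c. center_rep S X r N c T" c "\<lambda>c. sum c X"] assms(2) by blast
  have no_gap: "\<exists>z\<in>X. c z < v \<and> v \<le> c z + Suc N" if v: "v > 0" "v = c x0" "x0 \<in> X" for v x0
  proof (rule ccontr)
    assume "\<not> ?thesis"
    then have gap: "c z + Suc N < v" if "z \<in> X" "c z < v" for z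
      using that by (meson not_le)
    \<comment> \<open>Centers on different sides of the gap differ by more than
      \<open>N + 1\<close>, hence still by more than \<open>N\<close> after the shift; on the same
      side differences are kept. Since \<open>v > 0\<close>, the subtraction is not
      truncated.\<close>
    define d where "d y = (if v \<le> c y then c y - 1 else c y)" for y
    have "c x + N < c y \<longleftrightarrow> d x + N < d y" "c x + N = c y \<longleftrightarrow> d x + N = d y"
      if "x \<in> X" "y \<in> X" for x y
      using gap[of x] gap[of y] that v(1) unfolding d_def by auto
    then have "center_rep S X r N d T"
      using c unfolding center_rep_def by simp
    moreover have "sum d X < sum c X"
      using assms(1) v by (intro sum_strict_mono_ex1) (auto simp: d_def intro!: bexI[of _ x0])
    ultimately show False using least by (meson not_le)
  qed
  \<comment> \<open>Descending through occupied centers by at most \<open>Suc N\<close> at a time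
    ends at 0, and every descent leaves fewer elements strictly below.\<close>
  have bound: "c x \<le> Suc N * card {y \<in> X. c y < c x}" if "x \<in> X" for x
    using that
  proof (induction "c x" arbitrary: x rule: less_induct)
    case less
    show ?case
    proof (cases "c x = 0")
      case False
      then obtain z where z: "z \<in> X" "c z < c x" "c x \<le> c z + Suc N"
        using no_gap less.prems by blast
      have "card {y \<in> X. c y < c z} < card {y \<in> X. c y < c x}"
        using assms(1) z by (intro psubset_card_mono psubsetI) auto
      then have "Suc N * Suc (card {y \<in> X. c y < c z}) \<le> Suc N * card {y \<in> X. c y < c x}"
        by (intro mult_le_mono2) simp
      then show ?thesis using less.hyps[OF z(2,1)] z(3) by simp
    qed simp
  qed
  have "c x \<le> Suc N * card X" if "x \<in> X" for x
  proof -
    have "card {y \<in> X. c y < c x} \<le> card X" using assms(1) by (intro card_mono) auto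
    then have "Suc N * card {y \<in> X. c y < c x} \<le> Suc N * card X" by (rule mult_le_mono2)
    then show ?thesis using bound[OF that] by linarith
  qed
  then show thesis using that c by blast
qed

text \<open>This reduces representability to a finite search. Any bound \<open>N\<close> on the
  cardinality will do as half-length, so it can be taken from the code of the set.\<close>

lemma representation_iff_bounded:
  assumes "finite X" "card X \<le> N" "N > 0"
  shows "(\<exists>I. representation S X r I) \<longleftrightarrow>
    (\<exists>c T. center_rep S X r N c T \<and> (\<forall>x\<in>X. c x \<le> Suc N * N))"
proof
  assume "\<exists>I. representation S X r I"
  then obtain I where "representation S X r I" by blast
  then obtain h where "h > 0" "center_rep S X r h (\<lambda>x. center (I x)) (\<lambda>x. kind (I x))"
    by (rule representation_imp_center_rep)
  then obtain c' where "center_rep S X r N c' (\<lambda>x. kind (I x))"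
    using center_rep_real_to_nat assms by metis
  then obtain c where c: "center_rep S X r N c (\<lambda>x. kind (I x))"
    "\<And>x. x \<in> X \<Longrightarrow> c x \<le> Suc N * card X"
    using center_rep_nat_bounded assms(1) by metis
  have "Suc N * card X \<le> Suc N * N" using assms(2) by (rule mult_le_mono2)
  with c show "\<exists>c T. center_rep S X r N c T \<and> (\<forall>x\<in>X. c x \<le> Suc N * N)"
    by (meson order_trans)
next
  assume "\<exists>c T. center_rep S X r N c T \<and> (\<forall>x\<in>X. c x \<le> Suc N * N)"
  then obtain c T where "center_rep S X r N c T" by blast
  then have "center_rep S X r (real N) (\<lambda>x. real (c x)) T"
    unfolding center_rep_def by (simp flip: of_nat_add)
  then show "\<exists>I. representation S X r I"
    using center_rep_imp_representation assms(3) by (metis of_nat_0_less_iff)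
qed

section \<open>Computing with codes of sets and lists\<close>

lemma decidable_set_decode:
  assumes "computable k a" "computable k b"
  shows "decidable k (\<lambda>xs. a xs \<in> set_decode (b xs))"
  unfolding set_decode_def mem_Collect_eq using assms
  by (intro decidable_odd computable_div computability_intros)

text \<open>If bit \<open>x\<close> of \<open>n\<close> is set then \<open>2 ^ x \<le> n\<close>.
  Quantifiers over a coded set can thus be bounded by its code.\<close>

lemma set_decode_less: "x \<in> set_decode n \<Longrightarrow> x < n"
proof -
  assume "x \<in> set_decode n"
  then have "n div 2 ^ x \<noteq> 0" by (metis even_zero mem_Collect_eq set_decode_def)
  then have "2 ^ x \<le> n" by (meson div_less not_le)
  then show ?thesis using less_exp[of x] by linarith
qed

lemma card_set_decode_le: "card (set_decode n) \<le> n"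
  using card_mono[of "{..<n}" "set_decode n"] set_decode_less by auto

text \<open>A nonempty list is coded as the successor of the pair of its head and the code of its
  tail, so the tail is found by decoding the predecessor, and this is iterated.\<close>

lemma computable_list_encode_drop:
  assumes "computable k a" "computable k b"
  shows "computable k (\<lambda>xs. list_encode (drop (a xs) (list_decode (b xs))))"
proof (rule computable_cong)
  show "computable k (\<lambda>xs. rec_nat (b xs) (\<lambda>_ y. snd (prod_decode (y - 1))) (a xs))"
    using assms
    by (intro computable_rec_nat computable_snd_prod_decode computability_intros) auto
  \<comment> \<open>With this, the code 0 of the empty list is mapped to itself.\<close>
  have "prod_decode 0 = (0, 0)"
    using prod_encode_inverse[of "(0, 0)"] by (simp add: prod_encode_def)
  then have "list_encode (tl ys) = snd (prod_decode (list_encode ys - 1))" for ys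
    by (cases ys) auto
  then have "rec_nat l (\<lambda>_ y. snd (prod_decode (y - 1))) i = list_encode (drop i (list_decode l))" for i l
    by (induction i) (simp_all add: drop_Suc flip: tl_drop)
  then show "rec_nat (b xs) (\<lambda>_ y. snd (prod_decode (y - 1))) (a xs) =
      list_encode (drop (a xs) (list_decode (b xs)))" for xs .
qed

lemma length_list_decode_le: "length (list_decode l) \<le> l"
proof -
  have "length xs \<le> list_encode xs" for xs
  proof (induction xs)
    case (Cons x xs)
    then show ?case using le_prod_encode_2[of "list_encode xs" x] by simp
  qed simp
  then show ?thesis by (metis list_decode_inverse)
qed

lemma list_encode_eq_0_iff: "list_encode xs = 0 \<longleftrightarrow> xs = []"
  by (cases xs) auto

text \<open>The length is the number of nonempty suffixes; since it is at most the code, the sum may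
  stop there.\<close>

lemma computable_length_list_decode:
  assumes "computable k a"
  shows "computable k (\<lambda>xs. length (list_decode (a xs)))"
proof (rule computable_comp1[OF _ assms])
  have "computable 1 (\<lambda>xs. \<Sum>i<xs ! 0. of_bool (\<not> list_encode (drop i (list_decode (xs ! 0))) = 0))"
    by (intro computability_intros computable_list_encode_drop) auto
  then show "computable 1 (\<lambda>xs. length (list_decode (xs ! 0)))"
  proof (rule computable_cong)
    have "(\<Sum>i<l. of_bool (\<not> list_encode (drop i (list_decode l)) = 0)) = length (list_decode l)" for l
    proof -
      have "{i. i < l \<and> i < length (list_decode l)} = {..<length (list_decode l)}"
        using length_list_decode_le[of l] by auto
      then show ?thesis
        by (simp add: list_encode_eq_0_iff not_le of_bool_def sum.If_cases Int_def)
    qed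
    then show "(\<Sum>i<xs ! 0. of_bool (\<not> list_encode (drop i (list_decode (xs ! 0))) = 0)) =
        length (list_decode (xs ! 0))" for xs .
  qed
qed

text \<open>The head of the \<open>i\<close>-th suffix, meaningful for positions inside the
  list.\<close>

definition code_nth :: "nat \<Rightarrow> nat \<Rightarrow> nat" where
  "code_nth l i = fst (prod_decode (list_encode (drop i (list_decode l)) - 1))"

lemma code_nth: "i < length (list_decode l) \<Longrightarrow> code_nth l i = list_decode l ! i"
  unfolding code_nth_def by (simp flip: Cons_nth_drop_Suc)

lemma computable_code_nth:
  assumes "computable k a" "computable k b"
  shows "computable k (\<lambda>xs. code_nth (a xs) (b xs))"
  unfolding code_nth_def using assms
  by (intro computable_fst_prod_decode computable_list_encode_drop computability_intros)

lemma set_list_decode_less: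
  assumes "x \<in> set (list_decode l)"
  shows "x < l"
proof -
  have "x < list_encode xs" if "x \<in> set xs" for xs
    using that
  proof (induction xs)
    case (Cons y xs)
    then show ?case
      using le_prod_encode_1[of y "list_encode xs"] le_prod_encode_2[of "list_encode xs" y] by auto
  qed simp
  from this[OF assms] show ?thesis by simp
qed

text \<open>Translates the list of vertices of a cycle into the code of its vertex set, on which
  representability is then tested.\<close>

lemma computable_set_encode_list_decode:
  assumes "computable k a"
  shows "computable k (\<lambda>xs. set_encode (set (list_decode (a xs))))"
proof (rule computable_comp1[OF _ assms])
  have "computable 1 (\<lambda>xs. \<Sum>x<xs ! 0. if \<exists>i<length (list_decode (xs ! 0)). code_nth (xs ! 0) i = x
      then 2 ^ x else 0)"
    by (intro computability_intros computable_length_list_decode computable_code_nth) auto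
  then show "computable 1 (\<lambda>xs. set_encode (set (list_decode (xs ! 0))))"
  proof (rule computable_cong)
    have "(\<Sum>x<l. if \<exists>i<length (list_decode l). code_nth l i = x then 2 ^ x else 0) =
        set_encode (set (list_decode l))" for l
    proof -
      have "(\<exists>i<length (list_decode l). code_nth l i = x) \<longleftrightarrow> x \<in> set (list_decode l)" for x
        by (auto simp: in_set_conv_nth code_nth)
      moreover have "{..<l} \<inter> set (list_decode l) = set (list_decode l)"
        using set_list_decode_less by auto
      ultimately show ?thesis
        by (simp add: sum.If_cases set_encode_def)
    qed
    then show "(\<Sum>x<xs ! 0. if \<exists>i<length (list_decode (xs ! 0)). code_nth (xs ! 0) i = x
      then 2 ^ x else 0) = set_encode (set (list_decode (xs ! 0)))" for xs .
  qed
qed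

section \<open>Deciding representability and certificates\<close>

text \<open>Digit \<open>i\<close> of \<open>m\<close> in base \<open>b\<close>. A number thus codes
  a function with values below \<open>b\<close>, and a search over functions becomes a bounded
  search over numbers.\<close>

definition digit :: "nat \<Rightarrow> nat \<Rightarrow> nat \<Rightarrow> nat" where
  "digit b m i = m div b ^ i mod b"

lemma computable_digit:
  assumes "computable k a" "computable k b" "computable k c"
  shows "computable k (\<lambda>xs. digit (a xs) (b xs) (c xs))"
  unfolding digit_def using assms by (intro computable_div computable_mod computability_intros)

text \<open>The value at \<open>k\<close> is added as a new leading digit. For \<open>i < k\<close>
  the quotient by \<open>b ^ i\<close> changes only by a multiple of \<open>b\<close>, so the lower
  digits are kept.\<close>

lemma ex_digits:
  assumes "\<And>i. i < k \<Longrightarrow> f i < b"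
  shows "\<exists>m<b ^ k. \<forall>i<k. digit b m i = f i"
  using assms
proof (induction k)
  case (Suc k)
  then obtain m where m: "m < b ^ k" "\<And>i. i < k \<Longrightarrow> digit b m i = f i" by (metis less_SucI)
  let ?m = "m + f k * b ^ k"
  have "?m < Suc (f k) * b ^ k" using m(1) by simp
  also have "\<dots> \<le> b * b ^ k" using Suc.prems[of k] by (intro mult_le_mono1) auto
  finally have "?m < b ^ Suc k" by simp
  moreover have "digit b ?m i = f i" if "i < Suc k" for i
  proof (cases "i = k")
    case True
    then show ?thesis using m(1) Suc.prems[of k] by (simp add: digit_def)
  next
    case False
    then have i: "i < k" using that by simp
    then have "b ^ k = b ^ i * (b * b ^ (k - Suc i))"
      by (metis Suc_diff_Suc add_diff_inverse_nat less_imp_not_less power_Suc power_add)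
    moreover have "b ^ i \<noteq> 0" using Suc.prems[of i] that by auto
    ultimately have "?m div b ^ i = m div b ^ i + b * (f k * b ^ (k - Suc i))"
      using div_mult_self2[of "b ^ i" m "f k * (b * b ^ (k - Suc i))"] by (simp add: ac_simps)
    then show ?thesis using m(2)[OF i] by (simp add: digit_def)
  qed
  ultimately show ?case by blast
qed simp

definition type_of_code :: "nat \<Rightarrow> itype" where
  "type_of_code t = (if t = 0 then TypeA else if t = 1 then TypeB else if t = 2 then TypeC else TypeD)"

lemma type_of_code_type_code [simp]: "type_of_code (type_code t) = t"
  by (cases t) (auto simp: type_of_code_def)

lemma type_code_type_of_code [simp]: "t < 4 \<Longrightarrow> type_code (type_of_code t) = t"
  by (auto simp: type_of_code_def)

lemma type_code_less_4: "type_code t < 4"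
  by (cases t) auto

text \<open>Open ends belong to the odd codes 1 and 3, open centers to the codes 1 and 2.\<close>

definition tie_code :: "nat \<Rightarrow> nat \<Rightarrow> bool" where
  "tie_code s t \<longleftrightarrow> (odd s \<or> t = 1 \<or> t = 2) \<and> (odd t \<or> s = 1 \<or> s = 2)"

lemma tie_code_type_code: "tie_code (type_code s) (type_code t) \<longleftrightarrow> tie s t"
  by (cases s; cases t) (auto simp: tie_code_def tie_def)

lemma decidable_tie_code:
  assumes "computable k a" "computable k b"
  shows "decidable k (\<lambda>xs. tie_code (a xs) (b xs))"
  unfolding tie_code_def using assms by (intro decidable_odd computability_intros)

definition types_of :: "nat \<Rightarrow> itype set" where
  "types_of s = {t. type_code t \<in> set_decode s}"

definition rel_of :: "nat \<Rightarrow> nat rel" where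
  "rel_of p = {(x, y). prod_encode (x, y) \<in> set_decode p}"

lemma decidable_rel_of:
  assumes "computable k a" "computable k b" "computable k c"
  shows "decidable k (\<lambda>xs. (a xs, b xs) \<in> rel_of (c xs))"
  unfolding rel_of_def mem_Collect_eq prod.case
  using assms by (intro decidable_set_decode computable_prod_encode)

text \<open>A number \<open>m\<close> codes the centers and types of the elements of \<open>set_decode n\<close> by its digits
  \<open>4 * center + type\<close>; the half-length is \<open>Suc n\<close>.\<close>

definition digit_base :: "nat \<Rightarrow> nat" where
  "digit_base n = 4 * Suc (Suc (Suc n) * Suc n)"

definition center_of :: "nat \<Rightarrow> nat \<Rightarrow> nat \<Rightarrow> nat" where
  "center_of n m x = digit (digit_base n) m x div 4"

definition type_of :: "nat \<Rightarrow> nat \<Rightarrow> nat \<Rightarrow> nat" where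
  "type_of n m x = digit (digit_base n) m x mod 4"

text \<open>The quantifiers are bounded by \<open>n\<close>, above all elements of
  \<open>set_decode n\<close>, so that the rules for bounded quantifiers apply.\<close>

definition rep_code :: "nat \<Rightarrow> nat \<Rightarrow> nat \<Rightarrow> nat \<Rightarrow> bool" where
  "rep_code s n p m \<longleftrightarrow>
     (\<forall>x<n. x \<in> set_decode n \<longrightarrow> type_of n m x \<in> set_decode s) \<and>
     (\<forall>x<n. \<forall>y<n. x \<in> set_decode n \<and> y \<in> set_decode n \<longrightarrow>
        ((x, y) \<in> rel_of p \<longleftrightarrow> center_of n m x + Suc n < center_of n m y \<or>
          (center_of n m x + Suc n = center_of n m y \<and> tie_code (type_of n m x) (type_of n m y))))"

definition representable :: "nat \<Rightarrow> nat \<Rightarrow> nat \<Rightarrow> bool" where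
  "representable s n p \<longleftrightarrow> (\<exists>m<digit_base n ^ n. rep_code s n p m)"

lemma computable_digit_base: "computable k a \<Longrightarrow> computable k (\<lambda>xs. digit_base (a xs))"
  unfolding digit_base_def by (intro computability_intros)

lemma computable_center_of:
  assumes "computable k a" "computable k b" "computable k c"
  shows "computable k (\<lambda>xs. center_of (a xs) (b xs) (c xs))"
  unfolding center_of_def using assms
  by (intro computable_digit computable_digit_base computable_div computability_intros)

lemma computable_type_of:
  assumes "computable k a" "computable k b" "computable k c"
  shows "computable k (\<lambda>xs. type_of (a xs) (b xs) (c xs))"
  unfolding type_of_def using assms
  by (intro computable_digit computable_digit_base computable_mod computability_intros)

lemma decidable_rep_code:
  assumes "computable k a" "computable k b" "computable k c" "computable k d"
  shows "decidable k (\<lambda>xs. rep_code (a xs) (b xs) (c xs) (d xs))"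
proof (rule decidable_comp4[OF _ assms])
  show "decidable 4 (\<lambda>xs. rep_code (xs ! 0) (xs ! 1) (xs ! 2) (xs ! 3))"
    unfolding rep_code_def
    by (intro computability_intros decidable_set_decode decidable_rel_of decidable_tie_code
        computable_center_of computable_type_of) auto
qed

lemma decidable_representable:
  assumes "computable k a" "computable k b" "computable k c"
  shows "decidable k (\<lambda>xs. representable (a xs) (b xs) (c xs))"
proof (rule decidable_comp3[OF _ assms])
  show "decidable 3 (\<lambda>xs. representable (xs ! 0) (xs ! 1) (xs ! 2))"
    unfolding representable_def
    by (intro computability_intros decidable_rep_code computable_digit_base) auto
qed

lemma type_of_less: "type_of n m x < 4"
  unfolding type_of_def by simp

lemma rep_code_iff:
  "rep_code s n p m \<longleftrightarrow> center_rep (types_of s) (set_decode n) (rel_of p) (Suc n)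
     (center_of n m) (\<lambda>x. type_of_code (type_of n m x))"
proof -
  have "tie_code (type_of n m x) (type_of n m y) \<longleftrightarrow>
      tie (type_of_code (type_of n m x)) (type_of_code (type_of n m y))" for x y
    by (simp add: type_of_less flip: tie_code_type_code)
  moreover have "type_of_code (type_of n m x) \<in> types_of s \<longleftrightarrow> type_of n m x \<in> set_decode s" for x
    by (simp add: types_of_def type_of_less)
  ultimately show ?thesis
    unfolding rep_code_def center_rep_def using set_decode_less by blast
qed

lemma representable_iff:
  "representable s n p \<longleftrightarrow> (\<exists>I. representation (types_of s) (set_decode n) (rel_of p) I)"
proof -
  \<comment> \<open>The bound \<open>Suc n\<close> on the cardinality is positive even for the empty
    set, as a half-length must be.\<close>
  have bounded: "(\<exists>I. representation (types_of s) (set_decode n) (rel_of p) I) \<longleftrightarrow>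
    (\<exists>c T. center_rep (types_of s) (set_decode n) (rel_of p) (Suc n) c T \<and>
      (\<forall>x\<in>set_decode n. c x \<le> Suc (Suc n) * Suc n))"
    by (rule representation_iff_bounded) (use card_set_decode_le[of n] in auto)
  show ?thesis
  proof
    assume "representable s n p"
    then obtain m where m: "rep_code s n p m" unfolding representable_def by blast
    have "center_of n m x \<le> Suc (Suc n) * Suc n" for x
    proof -
      have "digit (digit_base n) m x < digit_base n" unfolding digit_def digit_base_def by simp
      then show ?thesis unfolding center_of_def digit_base_def by simp
    qed
    then show "\<exists>I. representation (types_of s) (set_decode n) (rel_of p) I"
      using m unfolding bounded rep_code_iff by blast
  next
    assume "\<exists>I. representation (types_of s) (set_decode n) (rel_of p) I"
    then obtain c T where cT: "center_rep (types_of s) (set_decode n) (rel_of p) (Suc n) c T"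
      "\<And>x. x \<in> set_decode n \<Longrightarrow> c x \<le> Suc (Suc n) * Suc n"
      unfolding bounded by blast
    \<comment> \<open>Each center within the bound fits into one digit together with its type.
      Positions outside the set get the digit 0.\<close>
    define f where "f x = (if x \<in> set_decode n then 4 * c x + type_code (T x) else 0)" for x
    have "f x < digit_base n" for x
    proof (cases "x \<in> set_decode n")
      case True
      then show ?thesis using cT(2)[OF True] type_code_less_4[of "T x"] by (simp add: f_def digit_base_def)
    qed (simp add: f_def digit_base_def)
    then obtain m where m: "m < digit_base n ^ n" "\<And>x. x < n \<Longrightarrow> digit (digit_base n) m x = f x"
      using ex_digits[of n f "digit_base n"] by blast
    have "center_of n m x = c x" "type_of n m x = type_code (T x)" if "x \<in> set_decode n" for x
      using m(2)[OF set_decode_less[OF that]] that type_code_less_4[of "T x"]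
      unfolding center_of_def type_of_def f_def by auto
    then have "rep_code s n p m"
      using cT(1) unfolding rep_code_iff center_rep_def by simp
    then show "representable s n p" using m(1) unfolding representable_def by blast
  qed
qed

definition incomparable_code :: "nat \<Rightarrow> nat \<Rightarrow> nat \<Rightarrow> bool" where
  "incomparable_code p x y \<longleftrightarrow> \<not> x = y \<and> \<not> (x, y) \<in> rel_of p \<and> \<not> (y, x) \<in> rel_of p"

text \<open>Comparing two counts decides the sign of the value without leaving the natural numbers.
  The relation \<open>p\<close> is not restricted to the cycle, since \<open>representation\<close>
  reads it only on the given set.\<close>

definition cert_code :: "nat \<Rightarrow> nat \<Rightarrow> nat \<Rightarrow> nat \<Rightarrow> bool" where
  "cert_code s n p l \<longleftrightarrow>
     1 < length (list_decode l) \<and>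
     (\<forall>i<length (list_decode l). code_nth l i \<in> set_decode n) \<and>
     code_nth l (length (list_decode l) - 1) = code_nth l 0 \<and>
     (\<forall>i<length (list_decode l) - 1. (code_nth l i, code_nth l (Suc i)) \<in> rel_of p \<or>
        incomparable_code p (code_nth l i) (code_nth l (Suc i))) \<and>
     ((\<Sum>i<length (list_decode l) - 1. of_bool (incomparable_code p (code_nth l i) (code_nth l (Suc i)))) <
        ((\<Sum>i<length (list_decode l) - 1. of_bool ((code_nth l i, code_nth l (Suc i)) \<in> rel_of p)) :: nat) \<or>
      ((\<Sum>i<length (list_decode l) - 1. of_bool (incomparable_code p (code_nth l i) (code_nth l (Suc i)))) =
        ((\<Sum>i<length (list_decode l) - 1. of_bool ((code_nth l i, code_nth l (Suc i)) \<in> rel_of p)) :: nat) \<and>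
       \<not> representable s (set_encode (set (list_decode l))) p))"

lemma decidable_incomparable_code:
  assumes "computable k a" "computable k b" "computable k c"
  shows "decidable k (\<lambda>xs. incomparable_code (a xs) (b xs) (c xs))"
  unfolding incomparable_code_def using assms by (intro computability_intros decidable_rel_of)

lemma decidable_cert_code:
  assumes "computable k a" "computable k b" "computable k c" "computable k d"
  shows "decidable k (\<lambda>xs. cert_code (a xs) (b xs) (c xs) (d xs))"
proof (rule decidable_comp4[OF _ assms])
  show "decidable 4 (\<lambda>xs. cert_code (xs ! 0) (xs ! 1) (xs ! 2) (xs ! 3))"
    unfolding cert_code_def
    by (intro computability_intros decidable_set_decode decidable_rel_of decidable_incomparable_code
        computable_length_list_decode computable_code_nth decidable_representable
        computable_set_encode_list_decode) auto
qed

lemma cert_code_iff: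
  "cert_code s n p l \<longleftrightarrow> certificate (types_of s) (set_decode n) (rel_of p) (list_decode l)"
proof (cases "1 < length (list_decode l)")
  case True
  define xs where "xs = list_decode l"
  \<comment> \<open>All positions read by \<open>cert_code\<close> lie inside a list of length above
    1; shorter lists are rejected on both sides.\<close>
  have nth: "code_nth l i = xs ! i" if "i < length xs" for i
    using that code_nth unfolding xs_def by simp
  have len: "1 < length xs" using True xs_def by simp
  have inc: "incomparable_code p x y \<longleftrightarrow> incomparable (rel_of p) x y" for x y
    by (auto simp: incomparable_code_def incomparable_def)
  have R: "(\<Sum>i<length xs - 1. of_bool ((code_nth l i, code_nth l (Suc i)) \<in> rel_of p)) =
      card {i. i < length xs - 1 \<and> (xs ! i, xs ! Suc i) \<in> rel_of p}"
  proof -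
    have "(\<Sum>i<length xs - 1. of_bool ((code_nth l i, code_nth l (Suc i)) \<in> rel_of p)) =
        (\<Sum>i<length xs - 1. (of_bool ((xs ! i, xs ! Suc i) \<in> rel_of p) :: nat))"
      by (intro sum.cong) (auto simp: nth)
    then show ?thesis by (simp add: of_bool_def sum.If_cases Int_def)
  qed
  have I: "(\<Sum>i<length xs - 1. of_bool (incomparable_code p (code_nth l i) (code_nth l (Suc i)))) =
      card {i. i < length xs - 1 \<and> incomparable (rel_of p) (xs ! i) (xs ! Suc i)}"
  proof -
    have "(\<Sum>i<length xs - 1. of_bool (incomparable_code p (code_nth l i) (code_nth l (Suc i)))) =
        (\<Sum>i<length xs - 1. (of_bool (incomparable (rel_of p) (xs ! i) (xs ! Suc i)) :: nat))"
      by (intro sum.cong) (auto simp: nth inc)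
    then show ?thesis by (simp add: of_bool_def sum.If_cases Int_def)
  qed
  have "forcing_cycle (set_decode n) (rel_of p) xs \<longleftrightarrow>
      (\<forall>i<length xs. code_nth l i \<in> set_decode n) \<and> code_nth l (length xs - 1) = code_nth l 0 \<and>
      (\<forall>i<length xs - 1. (code_nth l i, code_nth l (Suc i)) \<in> rel_of p \<or>
        incomparable_code p (code_nth l i) (code_nth l (Suc i)))"
  proof -
    have "set xs \<subseteq> set_decode n \<longleftrightarrow> (\<forall>i<length xs. code_nth l i \<in> set_decode n)"
      by (auto simp: nth in_set_conv_nth subset_iff)
    moreover have "last xs = code_nth l (length xs - 1)" "hd xs = code_nth l 0"
      using len nth[of 0] nth[of "length xs - 1"] by (cases xs; force simp: last_conv_nth)+
    moreover have "(\<forall>i<length xs - 1. (code_nth l i, code_nth l (Suc i)) \<in> rel_of p \<or>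
        incomparable_code p (code_nth l i) (code_nth l (Suc i))) \<longleftrightarrow>
      (\<forall>i<length xs - 1. (xs ! i, xs ! Suc i) \<in> rel_of p \<or> incomparable (rel_of p) (xs ! i) (xs ! Suc i))"
      by (auto simp: nth inc)
    ultimately show ?thesis unfolding forcing_cycle_def using len by simp
  qed
  moreover have "representable s (set_encode (set xs)) p \<longleftrightarrow>
      (\<exists>I. representation (types_of s) (set xs) (Restr (rel_of p) (set xs)) I)"
    unfolding representation_Restr representable_iff by simp
  ultimately show ?thesis
    unfolding cert_code_def certificate_def cycle_value_def R[unfolded xs_def] I[unfolded xs_def]
    using len unfolding xs_def by auto
next
  case False
  then show ?thesis unfolding cert_code_def certificate_def forcing_cycle_def by simp
qed

text \<open>The number \<open>v\<close> codes the lower part, the upper one being its complement. A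
  subset has a code at most \<open>n\<close>, and 0 and \<open>n\<close> code the two improper
  choices.\<close>

definition separable_code :: "nat \<Rightarrow> nat \<Rightarrow> bool" where
  "separable_code n p \<longleftrightarrow> (\<exists>v<Suc n. \<not> v = 0 \<and> \<not> v = n \<and>
     (\<forall>x<n. x \<in> set_decode v \<longrightarrow> x \<in> set_decode n) \<and>
     (\<forall>x<n. \<forall>y<n. x \<in> set_decode v \<and> y \<in> set_decode n \<and> \<not> y \<in> set_decode v \<longrightarrow> (x, y) \<in> rel_of p))"

lemma decidable_separable_code:
  assumes "computable k a" "computable k b"
  shows "decidable k (\<lambda>xs. separable_code (a xs) (b xs))"
proof (rule decidable_comp2[OF _ assms])
  show "decidable 2 (\<lambda>xs. separable_code (xs ! 0) (xs ! 1))"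
    unfolding separable_code_def
    by (intro computability_intros decidable_set_decode decidable_rel_of) auto
qed

lemma separable_code_iff: "separable_code n p \<longleftrightarrow> separable (set_decode n) (rel_of p)"
proof
  assume "separable_code n p"
  then obtain v where v: "v < Suc n" "v \<noteq> 0" "v \<noteq> n"
    "\<And>x. x < n \<Longrightarrow> x \<in> set_decode v \<Longrightarrow> x \<in> set_decode n"
    "\<And>x y. x < n \<Longrightarrow> y < n \<Longrightarrow> x \<in> set_decode v \<Longrightarrow> y \<in> set_decode n \<Longrightarrow> y \<notin> set_decode v \<Longrightarrow> (x, y) \<in> rel_of p"
    unfolding separable_code_def by blast
  have ne: "set_decode v \<noteq> {}" "set_decode v \<noteq> set_decode n"
    using v by (metis set_decode_inverse set_decode_zero)+
  have less: "x < n" if "x \<in> set_decode v" for x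
    using set_decode_less[OF that] v(1) by simp
  then have "set_decode v \<subseteq> set_decode n" using v(4) by blast
  then show "separable (set_decode n) (rel_of p)"
    unfolding separable_def using ne v(5) less set_decode_less[of _ n]
    by (intro exI[of _ "set_decode v"] exI[of _ "set_decode n - set_decode v"]) auto
next
  assume "separable (set_decode n) (rel_of p)"
  then obtain V W where VW: "V \<union> W = set_decode n" "V \<inter> W = {}" "V \<noteq> {}" "W \<noteq> {}"
    "\<And>v w. v \<in> V \<Longrightarrow> w \<in> W \<Longrightarrow> (v, w) \<in> rel_of p"
    unfolding separable_def by blast
  have fin: "finite V" using VW(1) by (metis finite_Un finite_set_decode)
  then have dec: "set_decode (set_encode V) = V" by simp
  have "set_encode V \<le> n" using VW(1) dec by (intro subset_decode_imp_le) auto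
  moreover have "set_encode V \<noteq> 0" using dec VW(3) by (metis set_decode_zero)
  moreover have "set_encode V \<noteq> n" using dec VW by auto
  ultimately show "separable_code n p"
    unfolding separable_code_def using dec VW by (intro exI[of _ "set_encode V"]) auto
qed

section \<open>Computing and verifying the output representation\<close>

definition rep_answer :: "nat \<Rightarrow> nat \<Rightarrow> answer" where
  "rep_answer n m = Rep (map (\<lambda>x. (x, (int (center_of n m x), 0),
      (int (center_of n m x + 2 * Suc n), 0), type_of_code (type_of n m x)))
     (rev (filter (\<lambda>x. x \<in> set_decode n) [0..<n])))"

lemma int_encode_of_nat: "int_encode (int k) = 2 * k"
  by (simp add: int_encode_def sum_encode_def)

text \<open>Entries are put in front of the list by recursion over \<open>x\<close>, directly on
  codes, so the largest element comes first; hence the reversal in \<open>rep_answer\<close>. The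
  outer factor 2 codes the left summand, the inner ones nonnegative integers.\<close>

lemma computable_rep_answer:
  assumes "computable k a" "computable k b"
  shows "computable k (\<lambda>xs. answer_code (rep_answer (a xs) (b xs)))"
proof (rule computable_comp2[OF _ assms])
  define entry where "entry n m x = prod_encode (x, prod_encode (prod_encode (2 * center_of n m x, 0),
      prod_encode (prod_encode (2 * (center_of n m x + 2 * Suc n), 0), type_of n m x)))" for n m x
  have "computable 2 (\<lambda>xs. 2 * rec_nat 0 (\<lambda>x y. if x \<in> set_decode (xs ! 0)
      then Suc (prod_encode (entry (xs ! 0) (xs ! 1) x, y)) else y) (xs ! 0))"
    unfolding entry_def
    by (intro computable_rec_nat computability_intros decidable_set_decode computable_prod_encode
        computable_center_of computable_type_of) auto
  then show "computable 2 (\<lambda>xs. answer_code (rep_answer (xs ! 0) (xs ! 1)))"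
  proof (rule computable_cong)
    have "rec_nat 0 (\<lambda>x y. if x \<in> set_decode n then Suc (prod_encode (entry n m x, y)) else y) k =
        list_encode (map (entry n m) (rev (filter (\<lambda>x. x \<in> set_decode n) [0..<k])))" for n m k
      by (induction k) auto
    then have "2 * rec_nat 0 (\<lambda>x y. if x \<in> set_decode n then Suc (prod_encode (entry n m x, y)) else y) n =
        answer_code (rep_answer n m)" for n m
      by (simp add: rep_answer_def sum_encode_def int_encode_of_nat entry_def[abs_def] comp_def
          type_of_less del: of_nat_add of_nat_mult of_nat_Suc)
    then show "2 * rec_nat 0 (\<lambda>x y. if x \<in> set_decode (xs ! 0)
        then Suc (prod_encode (entry (xs ! 0) (xs ! 1) x, y)) else y) (xs ! 0) =
        answer_code (rep_answer (xs ! 0) (xs ! 1))" for xs .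
  qed
qed

lemma rep_answer_correct:
  assumes "rep_code s n p m" "poset (set_decode n) (rel_of p)"
  shows "correct_answer (types_of s) (set_decode n) (rel_of p) (rep_answer n m)"
proof -
  define f :: "nat \<Rightarrow> finterval" where "f x = ((int (center_of n m x), 0),
      (int (center_of n m x + 2 * Suc n), 0), type_of_code (type_of n m x))" for x
  define ys where "ys = rev (filter (\<lambda>x. x \<in> set_decode n) [0..<n])"
  define ps where "ps = map (\<lambda>x. (x, f x)) ys"
  \<comment> \<open>The stored number serves as left end, so the center lies \<open>Suc n\<close> to
    its right. All endpoints are then natural numbers, with denominator 1.\<close>
  define c where "c x = real (center_of n m x) + real (Suc n)" for x
  define T where "T x = type_of_code (type_of n m x)" for x
  have ys: "set ys = set_decode n" "distinct ys"
    unfolding ys_def using set_decode_less by auto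
  have fst_ps: "map fst ps = ys" unfolding ps_def by (simp add: comp_def)
  have "c x + real (Suc n) < c y \<longleftrightarrow> center_of n m x + Suc n < center_of n m y"
    "c x + real (Suc n) = c y \<longleftrightarrow> center_of n m x + Suc n = center_of n m y" for x y
    unfolding c_def by linarith+
  then have "center_rep (types_of s) (set_decode n) (rel_of p) (real (Suc n)) c T"
    using assms(1) unfolding rep_code_iff center_rep_def T_def by simp
  then have rep: "representation (types_of s) (set_decode n) (rel_of p)
      (\<lambda>x. Interval (c x - real (Suc n)) (c x + real (Suc n)) (T x))"
    by (intro center_rep_imp_representation) auto
  have "assignment ps x = Interval (c x - real (Suc n)) (c x + real (Suc n)) (T x)"
    if "x \<in> set_decode n" for x
    using that ys(1) unfolding assignment_def ps_def map_of_map_restrict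
    by (simp add: f_def c_def T_def)
  with rep have "representation (types_of s) (set_decode n) (rel_of p) (assignment ps)"
    unfolding representation_def by simp
  moreover have "rep_answer n m = Rep ps"
    unfolding rep_answer_def ps_def ys_def f_def ..
  ultimately show ?thesis
    using fst_ps ys assms(2) by (auto simp: S_order_def simp del: set_map)
qed

text \<open>The disjuncts other than \<open>cert_code\<close> only make the search total on inputs that do not
  satisfy the hypotheses or need no certificate.\<close>

definition search_cert :: "nat \<Rightarrow> nat \<Rightarrow> nat \<Rightarrow> nat" where
  "search_cert s n p = (LEAST l. cert_code s n p l \<or>
     representable s n p \<or> separable_code n p \<or> (\<forall>t<4. \<not> t \<in> set_decode s))"

text \<open>The implication makes the search total.\<close>

definition search_rep :: "nat \<Rightarrow> nat \<Rightarrow> nat \<Rightarrow> nat" where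
  "search_rep s n p = (LEAST m. representable s n p \<longrightarrow> rep_code s n p m)"

lemma types_of_empty: "types_of s = {} \<longleftrightarrow> (\<forall>t<4. t \<notin> set_decode s)"
  unfolding types_of_def using type_code_less_4 type_code_type_of_code by (metis (mono_tags) Collect_empty_eq)

text \<open>Unbounded search needs a hit for every triple of numbers; when the other disjuncts fail,
  \<open>representation_or_certificate\<close> provides one.\<close>

lemma cert_code_ex:
  "\<exists>l. cert_code s n p l \<or> representable s n p \<or> separable_code n p \<or> (\<forall>t<4. \<not> t \<in> set_decode s)"
proof -
  have "\<exists>l. cert_code s n p l"
    if "\<not> representable s n p" "\<not> separable_code n p" "types_of s \<noteq> {}"
  proof -
    have "\<exists>xs. certificate (types_of s) (set_decode n) (rel_of p) xs"
      using representation_or_certificate[of "set_decode n" "rel_of p" "types_of s"] that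
      by (auto simp: representable_iff separable_code_iff inseparable_def)
    then show ?thesis unfolding cert_code_iff by (metis list_encode_inverse)
  qed
  then show ?thesis unfolding types_of_empty by blast
qed

lemma rep_code_ex: "\<exists>m. representable s n p \<longrightarrow> rep_code s n p m"
  unfolding representable_def by blast

lemma computable_search_cert:
  assumes "computable k a" "computable k b" "computable k c"
  shows "computable k (\<lambda>xs. search_cert (a xs) (b xs) (c xs))"
proof (rule computable_comp3[OF _ assms])
  show "computable 3 (\<lambda>xs. search_cert (xs ! 0) (xs ! 1) (xs ! 2))"
    unfolding search_cert_def
    by (intro computable_Least cert_code_ex computability_intros decidable_cert_code
        decidable_representable decidable_separable_code decidable_set_decode) auto
qed

lemma computable_search_rep:
  assumes "computable k a" "computable k b" "computable k c"
  shows "computable k (\<lambda>xs. search_rep (a xs) (b xs) (c xs))"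
proof (rule computable_comp3[OF _ assms])
  show "computable 3 (\<lambda>xs. search_rep (xs ! 0) (xs ! 1) (xs ! 2))"
    unfolding search_rep_def
    by (intro computable_Least rep_code_ex computability_intros decidable_rep_code
        decidable_representable) auto
qed

text \<open>The number found by \<open>search_cert\<close> is already the code of a list;
  \<open>Suc (2 * l)\<close> marks it as the right summand, a certificate.\<close>

definition solve :: "nat \<Rightarrow> nat \<Rightarrow> nat \<Rightarrow> nat" where
  "solve s n p = (if representable s n p then answer_code (rep_answer n (search_rep s n p))
     else Suc (2 * search_cert s n p))"

lemma computable_solve:
  assumes "computable k a" "computable k b" "computable k c"
  shows "computable k (\<lambda>xs. solve (a xs) (b xs) (c xs))"
  unfolding solve_def using assms
  by (intro computability_intros computable_rep_answer decidable_representable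
      computable_search_rep computable_search_cert)

lemma solve_correct:
  assumes "types_of s \<noteq> {}" "poset (set_decode n) (rel_of p)" "inseparable (set_decode n) (rel_of p)"
  shows "\<exists>ans. solve s n p = answer_code ans \<and>
    correct_answer (types_of s) (set_decode n) (rel_of p) ans"
proof (cases "representable s n p")
  case True
  then have "rep_code s n p (search_rep s n p)"
    using LeastI_ex[OF rep_code_ex[of s n p]] unfolding search_rep_def by blast
  from rep_answer_correct[OF this assms(2)] show ?thesis using True by (auto simp: solve_def)
next
  case False
  \<comment> \<open>The hypotheses and \<open>False\<close> exclude the other disjuncts, so the
    search has stopped at a certificate.\<close>
  have "cert_code s n p (search_cert s n p)"
    using LeastI_ex[OF cert_code_ex[of s n p]] False assms(1,3)
    unfolding search_cert_def types_of_empty separable_code_iff inseparable_def by blast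
  moreover have "solve s n p = answer_code (Cert (list_decode (search_cert s n p)))"
    using False by (simp add: solve_def sum_encode_def)
  moreover have "\<not> S_order (types_of s) (set_decode n) (rel_of p)"
    using False by (simp add: representable_iff S_order_def)
  ultimately show ?thesis unfolding cert_code_iff
    by (intro exI[of _ "Cert (list_decode (search_cert s n p))"]) auto
qed

theorem theorem26:
  "\<exists>F. general_recursive 1 F \<and>
     (\<forall>S X r. S \<noteq> {} \<and> finite X \<and> poset X r \<and> twin_free X r \<and> inseparable X r \<longrightarrow>
        (\<exists>ans. F [input_code S X r] = answer_code ans \<and> correct_answer S X r ans))"
proof -
  let ?F = "\<lambda>xs. solve (fst (prod_decode (xs ! 0))) (fst (prod_decode (snd (prod_decode (xs ! 0)))))
      (snd (prod_decode (snd (prod_decode (xs ! 0)))))"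
  have "computable 1 ?F"
    by (intro computable_solve computable_fst_prod_decode computable_snd_prod_decode
        computability_intros) auto
  then obtain F where F: "general_recursive 1 F" "\<And>xs. length xs = 1 \<Longrightarrow> F xs = ?F xs"
    unfolding computable_def by auto
  have "\<exists>ans. F [input_code S X r] = answer_code ans \<and> correct_answer S X r ans"
    if "S \<noteq> {}" "finite X" "poset X r" "inseparable X r" for S X r
  proof -
    define s n p where "s = set_encode (type_code ` S)" "n = set_encode X"
      "p = set_encode (prod_encode ` r)"
    have "r \<subseteq> X \<times> X" using that(3) unfolding poset_def by simp
    then have "finite r" using that(2) by (meson finite_SigmaI finite_subset)
    then have r: "rel_of p = r"
      unfolding rel_of_def s_n_p_def by (auto simp: inj_image_mem_iff[OF inj_prod_encode])
    have "finite (type_code ` S)" using type_code_less_4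
      by (meson finite_lessThan finite_subset image_subsetI lessThan_iff)
    moreover have "inj type_code" by (metis injI type_of_code_type_code)
    ultimately have S: "types_of s = S"
      unfolding types_of_def s_n_p_def by (auto simp: inj_image_mem_iff)
    have X: "set_decode n = X" unfolding s_n_p_def using that(2) by simp
    have "F [input_code S X r] = solve s n p"
      using F(2)[of "[input_code S X r]"] by (simp add: input_code_def s_n_p_def)
    then show ?thesis using solve_correct[of s n p] that unfolding S X r by simp
  qed
  then show ?thesis using F(1) by blast
qed

end
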